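(* Let $n,D\ge 1$ be integers, let $m(n,D)=\binom{n+D}{n}$, and let $\mu$ be a Borel probability measure on $\mathbb{R}^n$. (i) There exists a weak $\left(1-\frac{1}{m(n,D)}\right)$-net of $(\mu,\mathrm{Poly}_+(n,D))$ of size at most $\kappa(V(n,D))$. (ii) If $D$ is even and $\mu$ is absolutely continuous with respect to the Lebesgue measure, then for every $\delta>0$ there exists a weak $\left(1-\frac{1}{m(n,D)+1}+\delta\right)$-net of $(\mu,\mathrm{Poly}_+(n,D))$ of size at most $\kappa(\hat V(n+1,D))$.
   Context: $\mathrm{Poly}(n,D)$ is the real vector space of polynomials in $n$ variables with real coefficients of degree at most $D$; its dimension is $m(n,D)=\binom{n+D}{n}$. $\mathrm{Poly}_+(n,D)=\{\{x\in\mathbb{R}^n : P(x)\ge 0\} : P\in \mathrm{Poly}(n,D)\}$ is the family of superlevel sets of such polynomials. For a family $F$ of subsets of $\mathbb{R}^n$, a probability measure $\mu$ on $\mathbb{R}^n$ and a real number $t$, a set $X\subset\mathbb{R}^n$ is a $t$-net for $(\mu,F)$ if for every $f\in F$ with $\mu(f)>t$ one has $f\cap X\ne\emptyset$. The net is called weak to indicate that $X$ may be any subset of $\mathbb{R}^n$ (it need not lie in the support of $\mu$). The size of a net is its cardinality. The real affine Veronese variety $V(n,D)\subset\mathbb{R}^{m(n,D)-1}$ is the image of the map $v:\mathbb{R}^n\to\mathbb{R}^{m(n,D)-1}$ sending a point to the vector of all nonconstant monomials in its $n$ coordinates of degree at most $D$. The real Veronese cone $\hat V(n+1,D)\subset\mathbb{R}^{m(n,D)}$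 is the image of the map $\hat v:\mathbb{R}^{n+1}\to\mathbb{R}^{m(n,D)}$ sending a point to the vector of all monomials in its $n+1$ coordinates of degree exactly $D$. For a subset $S$ of a real vector space, the Carathéodory number $\kappa(S)$ is the minimal integer such that every point of the convex hull $\mathrm{conv}(S)$ is a convex combination of at most $\kappa(S)$ points of $S$. *)

theory Defs
  imports "HOL-Probability.Probability" "HOL-Analysis.Finite_Function_Topology"
begin

text \<open>
  Points of \<open>n\<close>-space are vectors of type \<^typ>\<open>real ^ 'i\<close> with \<open>n\<close> the cardinality of \<^typ>\<open>'i\<close>.
  A finitely supported map \<^typ>\<open>'i \<Rightarrow>\<^sub>0 nat\<close> is the exponent vector of a monomial in the
  coordinates, and \<^typ>\<open>('i \<Rightarrow>\<^sub>0 nat) \<Rightarrow>\<^sub>0 real\<close> is both the space of polynomials (coefficient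
  vectors) and the real vector space, with coordinates labelled by monomials, that the Veronese
  maps take values in.
\<close>

definition total_degree :: "('i::finite \<Rightarrow>\<^sub>0 nat) \<Rightarrow> nat"
  where "total_degree \<alpha> = (\<Sum>i\<in>UNIV. Poly_Mapping.lookup \<alpha> i)"

definition eval_monomial :: "('i::finite \<Rightarrow>\<^sub>0 nat) \<Rightarrow> real ^ 'i \<Rightarrow> real"
  where "eval_monomial \<alpha> x = (\<Prod>i\<in>UNIV. (x $ i) ^ Poly_Mapping.lookup \<alpha> i)"

definition eval_poly :: "(('i::finite \<Rightarrow>\<^sub>0 nat) \<Rightarrow>\<^sub>0 real) \<Rightarrow> real ^ 'i \<Rightarrow> real"
  where "eval_poly P x = (\<Sum>\<alpha>\<in>Poly_Mapping.keys P. Poly_Mapping.lookup P \<alpha> * eval_monomial \<alpha> x)"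

definition Poly :: "nat \<Rightarrow> (('i::finite \<Rightarrow>\<^sub>0 nat) \<Rightarrow>\<^sub>0 real) set"
  where "Poly D = {P. \<forall>\<alpha>\<in>Poly_Mapping.keys P. total_degree \<alpha> \<le> D}"

definition Poly_plus :: "nat \<Rightarrow> (real ^ 'i::finite) set set"
  where "Poly_plus D = {{x. eval_poly P x \<ge> 0} | P. P \<in> Poly D}"

definition weak_net :: "real \<Rightarrow> 'a measure \<Rightarrow> 'a set set \<Rightarrow> 'a set \<Rightarrow> bool"
  where "weak_net t \<mu> F X \<longleftrightarrow> (\<forall>f\<in>F. measure \<mu> f > t \<longrightarrow> f \<inter> X \<noteq> {})"

text \<open>
  The sums over exponents below are genuine finite sums, because only finitely many exponents have
  bounded total degree.
\<close>

lemma finite_total_degree_le: "finite {\<alpha> :: 'i::finite \<Rightarrow>\<^sub>0 nat. total_degree \<alpha> \<le> D}"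
proof (rule finite_imageD)
  have "Poly_Mapping.lookup \<alpha> i \<le> D" if "total_degree \<alpha> \<le> D" for \<alpha> :: "'i \<Rightarrow>\<^sub>0 nat" and i
    using that member_le_sum[of i UNIV "Poly_Mapping.lookup \<alpha>"] by (simp add: total_degree_def)
  then have "Poly_Mapping.lookup ` {\<alpha> :: 'i \<Rightarrow>\<^sub>0 nat. total_degree \<alpha> \<le> D} \<subseteq> (\<Pi>\<^sub>E i\<in>UNIV. {..D})"
    by (auto simp: PiE_UNIV_domain)
  then show "finite (Poly_Mapping.lookup ` {\<alpha> :: 'i \<Rightarrow>\<^sub>0 nat. total_degree \<alpha> \<le> D})"
    by (rule finite_subset) (simp add: finite_PiE)
  show "inj_on Poly_Mapping.lookup {\<alpha> :: 'i \<Rightarrow>\<^sub>0 nat. total_degree \<alpha> \<le> D}"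
    by (simp add: inj_on_def poly_mapping.lookup_inject)
qed

definition veronese_map :: "nat \<Rightarrow> real ^ 'i::finite \<Rightarrow> (('i \<Rightarrow>\<^sub>0 nat) \<Rightarrow>\<^sub>0 real)"
  where "veronese_map D x =
    (\<Sum>\<alpha> | 1 \<le> total_degree \<alpha> \<and> total_degree \<alpha> \<le> D. Poly_Mapping.single \<alpha> (eval_monomial \<alpha> x))"

definition veronese_variety :: "nat \<Rightarrow> (('i::finite \<Rightarrow>\<^sub>0 nat) \<Rightarrow>\<^sub>0 real) set"
  where "veronese_variety D = range (veronese_map D)"

definition veronese_cone_map :: "nat \<Rightarrow> real ^ 'i::finite \<Rightarrow> (('i \<Rightarrow>\<^sub>0 nat) \<Rightarrow>\<^sub>0 real)"
  where "veronese_cone_map D x =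
    (\<Sum>\<alpha> | total_degree \<alpha> = D. Poly_Mapping.single \<alpha> (eval_monomial \<alpha> x))"

definition veronese_cone :: "nat \<Rightarrow> (('i::finite \<Rightarrow>\<^sub>0 nat) \<Rightarrow>\<^sub>0 real) set"
  where "veronese_cone D = range (veronese_cone_map D)"

text \<open>
  The coordinates of the Veronese maps are the expected monomials, so in \<open>n\<close> and \<open>n + 1\<close>
  variables respectively their images lie in coordinate subspaces of dimension
  \<open>((n + D) choose n) - 1\<close> and \<open>(n + D) choose n\<close>, which contain the convex hulls.
\<close>

lemma lookup_veronese_map:
  "Poly_Mapping.lookup (veronese_map D x) \<alpha> =
    (if 1 \<le> total_degree \<alpha> \<and> total_degree \<alpha> \<le> D then eval_monomial \<alpha> x else 0)"
proof -
  have "finite {\<alpha> :: 'a \<Rightarrow>\<^sub>0 nat. 1 \<le> total_degree \<alpha> \<and> total_degree \<alpha> \<le> D}"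
    by (rule finite_subset[OF _ finite_total_degree_le[of D]]) auto
  then show ?thesis
    by (simp add: veronese_map_def lookup_sum lookup_single when_def sum.delta)
qed

lemma lookup_veronese_cone_map:
  "Poly_Mapping.lookup (veronese_cone_map D x) \<alpha> = (if total_degree \<alpha> = D then eval_monomial \<alpha> x else 0)"
proof -
  have "finite {\<alpha> :: 'a \<Rightarrow>\<^sub>0 nat. total_degree \<alpha> = D}"
    by (rule finite_subset[OF _ finite_total_degree_le[of D]]) auto
  then show ?thesis
    by (simp add: veronese_cone_map_def lookup_sum lookup_single when_def sum.delta)
qed

text \<open>
  The least such \<open>k\<close> exists whenever \<open>S\<close> spans a finite-dimensional space, by Caratheodory's
  theorem; for other \<open>S\<close> the value is unspecified.
\<close>

definition caratheodory_number :: "'a::real_vector set \<Rightarrow> nat"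
  where "caratheodory_number S = (LEAST k. \<forall>x\<in>convex hull S. \<exists>T u.
    finite T \<and> T \<subseteq> S \<and> card T \<le> k \<and> (\<forall>v\<in>T. 0 \<le> u v) \<and> sum u T = 1 \<and> (\<Sum>v\<in>T. u v *\<^sub>R v) = x)"

end

theory Submission
  imports Defs
begin

text \<open>
  Choose a ball \<open>K\<close> with \<open>\<mu> K > 1 - 1/m\<close>. Any \<open>m\<close> sets of measure larger than \<open>1 - 1/m\<close> have a
  common point, so by Helly's theorem in the \<open>(m - 1)\<close>-dimensional space containing the Veronese
  variety, and by compactness of \<open>K\<close>, there is a point \<open>c\<close> in the convex hull of the image of \<open>K\<close>
  that lies in every closed half-space of measure larger than \<open>1 - 1/m\<close>. Using \<open>K\<close> itself as one of
  the sets puts \<open>c\<close> in the convex hull of the variety and not merely in its closure. Writing \<open>c\<close> as a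
  convex combination of few points of the variety gives (i).

  For (ii), \<open>c\<close> is written as a combination of few points of the Veronese cone, and those at infinity
  are moved to height \<open>\<epsilon>\<close>. If this fails to be a net for all small \<open>\<epsilon>\<close>, then normalised
  counterexamples converge to a nonzero polynomial \<open>Q\<close> with \<open>c(Q) \<le> 0\<close> whose superlevel set has
  measure larger than \<open>1 - 1/m\<close>. As the zero set of \<open>Q\<close> is null, the same holds for \<open>Q - \<eta>\<close> with
  some \<open>\<eta> > 0\<close>, so \<open>c(Q) \<ge> \<eta>\<close>, a contradiction.
\<close>

section \<open>Helly and Caratheodory in real vector spaces\<close>

text \<open>For an indexed family, a repeated value already gives a relation
  \<open>f i - f j = 0\<close>; distinct values are more vectors than the span of \<open>B\<close>
  allows to be independent.\<close>

lemma exists_dependency: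
  fixes f :: "'a \<Rightarrow> 'b::real_vector"
  assumes "finite I" "finite B" "f ` I \<subseteq> span B" "card B < card I"
  shows "\<exists>a. (\<exists>i\<in>I. a i \<noteq> 0) \<and> (\<Sum>i\<in>I. a i *\<^sub>R f i) = 0"
proof (cases "inj_on f I")
  case True
  have "dependent (f ` I)"
    using independent_span_bound[of B "f ` I"] assms card_image[OF True] by fastforce
  then obtain u where u: "\<exists>v\<in>f ` I. u v \<noteq> 0" "(\<Sum>v\<in>f ` I. u v *\<^sub>R v) = 0"
    using assms(1) by (auto simp: dependent_finite)
  show ?thesis
    by (rule exI[of _ "u \<circ> f"]) (use u True in \<open>auto simp: sum.reindex\<close>)
next
  case False
  then obtain i j where ij: "i \<in> I" "j \<in> I" "i \<noteq> j" "f i = f j"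
    by (auto simp: inj_on_def)
  define a :: "'a \<Rightarrow> real" where "a k = (if k = i then 1 else 0) - (if k = j then 1 else 0)" for k
  have "(\<Sum>k\<in>I. a k *\<^sub>R f k) = 0"
    using ij assms(1) by (simp add: a_def scaleR_diff_left sum_subtractf if_distrib[of "\<lambda>c. c *\<^sub>R _"] cong: if_cong)
  moreover have "a i \<noteq> 0" using ij by (simp add: a_def)
  ultimately show ?thesis using ij by blast
qed

text \<open>Apply linear dependency to the differences from one member \<open>f k\<close> and choose
  the coefficient of \<open>f k\<close> so that the total vanishes. Coefficients that sum to 0 and
  are not all 0 include a positive one.\<close>

lemma exists_affine_dependency:
  fixes f :: "'a \<Rightarrow> 'b::real_vector"
  assumes "finite I" "finite B" "f ` I \<subseteq> span B" "card B + 1 < card I"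
  shows "\<exists>a. (\<exists>i\<in>I. 0 < a i) \<and> sum a I = 0 \<and> (\<Sum>i\<in>I. a i *\<^sub>R f i) = 0"
proof -
  obtain k where k: "k \<in> I" using assms(4) by fastforce
  have "(\<lambda>i. f i - f k) ` (I - {k}) \<subseteq> span B"
    using assms(3) k by (auto intro!: span_diff)
  moreover have "card B < card (I - {k})" using assms k by simp
  ultimately obtain b where b: "\<exists>i\<in>I - {k}. b i \<noteq> 0" "(\<Sum>i\<in>I - {k}. b i *\<^sub>R (f i - f k)) = 0"
    using exists_dependency[of "I - {k}" B] assms by blast
  define a where "a i = (if i = k then - sum b (I - {k}) else b i)" for i
  have s: "sum a I = 0"
    using assms(1) k by (simp add: sum.remove[of I k] a_def)
  have v: "(\<Sum>i\<in>I. a i *\<^sub>R f i) = 0"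
    using assms(1) k b(2)
    by (simp add: sum.remove[of I k] a_def scaleR_diff_right sum_subtractf scaleR_sum_left)
  obtain i where i: "i \<in> I" "a i \<noteq> 0" using b(1) by (metis DiffE a_def insertCI)
  have "\<exists>i\<in>I. 0 < a i"
  proof (rule ccontr)
    assume "\<not> ?thesis"
    then have "\<forall>i\<in>I. a i \<le> 0" by force
    then show False
      using sum_nonneg_eq_0_iff[of I "\<lambda>i. - a i"] s i assms(1) by (auto simp: sum_negf)
  qed
  with s v show ?thesis by blast
qed

text \<open>Radon's argument, by induction on the number of sets. The dimension enters as the size
  of a finite spanning set \<open>B\<close>, so the result applies inside an infinite-dimensional
  type.\<close>

lemma helly_span:
  fixes C :: "'a \<Rightarrow> 'b::real_vector set"
  assumes B: "finite B" and "finite I"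
    and cv: "\<And>i. i \<in> I \<Longrightarrow> convex (C i)" and sp: "\<And>i. i \<in> I \<Longrightarrow> C i \<subseteq> span B"
    and small: "\<And>J. J \<subseteq> I \<Longrightarrow> card J \<le> card B + 1 \<Longrightarrow> \<exists>x. \<forall>j\<in>J. x \<in> C j"
  shows "\<exists>x. \<forall>i\<in>I. x \<in> C i"
  using \<open>finite I\<close> cv sp small
proof (induction "card I" arbitrary: I rule: less_induct)
  case less
  show ?case
  proof (cases "card I \<le> card B + 1")
    case True
    then show ?thesis using less.prems(4) by blast
  next
    case False
    \<comment> \<open>Leaving out one set at a time, the induction hypothesis supplies
      \<open>x i\<close> in every \<open>C j\<close> with j different from i.\<close>
    have "\<exists>x. \<forall>j\<in>I - {i}. x \<in> C j" if "i \<in> I" for i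
    proof (rule less.hyps)
      show "card (I - {i}) < card I" using that less.prems(1) by (rule card_Diff1_less[rotated])
      show "finite (I - {i})" using less.prems(1) by simp
      show "\<exists>x. \<forall>j\<in>J. x \<in> C j" if "J \<subseteq> I - {i}" "card J \<le> card B + 1" for J
        using less.prems(4)[of J] that by blast
    qed (use less.prems(2,3) in auto)
    then obtain x where x: "\<And>i j. i \<in> I \<Longrightarrow> j \<in> I \<Longrightarrow> i \<noteq> j \<Longrightarrow> x i \<in> C j"
    proof -
      have "\<forall>i\<in>I. \<exists>x. \<forall>j\<in>I - {i}. x \<in> C j"
        using \<open>\<And>i. i \<in> I \<Longrightarrow> \<exists>x. \<forall>j\<in>I - {i}. x \<in> C j\<close> by blast
      then obtain x where "\<forall>i\<in>I. \<forall>j\<in>I - {i}. x i \<in> C j"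
        unfolding bchoice_iff by blast
      then show ?thesis by (intro that) blast
    qed
    have "x i \<in> span B" if i: "i \<in> I" for i
    proof -
      have "I - {i} \<noteq> {}"
      proof
        assume "I - {i} = {}"
        then have "card I \<le> card {i}" by (intro card_mono) auto
        with False show False by simp
      qed
      then show ?thesis using x[OF i] less.prems(3) by blast
    qed
    then obtain a where a: "\<exists>i\<in>I. 0 < a i" "sum a I = 0" "(\<Sum>i\<in>I. a i *\<^sub>R x i) = 0"
      using exists_affine_dependency[of I B x] less.prems(1) B False by auto
    \<comment> \<open>Radon partition: the positive part and the nonpositive part of the dependency,
      each normalised by \<open>s\<close>, represent the same point \<open>z\<close>.\<close>
    define P where "P = {i\<in>I. 0 < a i}"
    define Q where "Q = I - P"
    have fin: "finite P" "finite Q" using less.prems(1) by (simp_all add: P_def Q_def)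
    have split: "sum g I = sum g P + sum g Q" for g :: "'a \<Rightarrow> 'c::ab_group_add"
      unfolding Q_def using less.prems(1) by (subst sum.subset_diff[of P I]) (auto simp: P_def add.commute)
    define s where "s = sum a P"
    have s: "s > 0" unfolding s_def
      using a(1) fin(1) by (intro sum_pos) (auto simp: P_def)
    have sQ: "sum a Q = - s"
      using a(2) split[of a] by (simp add: s_def)
    define z where "z = (\<Sum>i\<in>P. (a i / s) *\<^sub>R x i)"
    have "(\<Sum>i\<in>P. a i *\<^sub>R x i) = (\<Sum>i\<in>Q. (- a i) *\<^sub>R x i)"
      using a(3) split[of "\<lambda>i. a i *\<^sub>R x i"] by (simp add: sum_negf eq_neg_iff_add_eq_0)
    moreover have "z = inverse s *\<^sub>R (\<Sum>i\<in>P. a i *\<^sub>R x i)"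
      by (simp add: z_def divide_inverse mult.commute scaleR_sum_right)
    ultimately have "z = inverse s *\<^sub>R (\<Sum>i\<in>Q. (- a i) *\<^sub>R x i)"
      by simp
    then have zQ: "z = (\<Sum>i\<in>Q. (- a i / s) *\<^sub>R x i)"
      by (simp add: divide_inverse mult.commute scaleR_sum_right)
    \<comment> \<open>Of the two representations of \<open>z\<close>, take the one whose indices
      avoid j: all of its points lie in \<open>C j\<close>.\<close>
    have "z \<in> C j" if j: "j \<in> I" for j
    proof (cases "j \<in> P")
      case True
      show ?thesis unfolding zQ
      proof (rule convex_sum)
        show "(\<Sum>i\<in>Q. - a i / s) = 1"
          using sQ s by (simp add: sum_divide_distrib[symmetric] sum_negf)
      qed (use True fin(2) less.prems(2) x j s in \<open>auto simp: P_def Q_def divide_le_0_iff\<close>)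
    next
      case False
      show ?thesis unfolding z_def
      proof (rule convex_sum)
        show "(\<Sum>i\<in>P. a i / s) = 1"
          using s by (simp add: sum_divide_distrib[symmetric] s_def)
      qed (use False fin(1) less.prems(2) x j s in \<open>auto simp: P_def\<close>)
    qed
    then show ?thesis by blast
  qed
qed

text \<open>In a representation with the fewest points, more than \<open>card B + 1\<close> points
  would admit an affine dependency, along which the weights can be shifted until one of them
  vanishes.\<close>

lemma caratheodory_span:
  fixes S :: "'a::real_vector set"
  assumes "finite B" "S \<subseteq> span B" "x \<in> convex hull S"
  shows "\<exists>T u. finite T \<and> T \<subseteq> S \<and> card T \<le> card B + 1 \<and>
    (\<forall>v\<in>T. 0 \<le> u v) \<and> sum u T = 1 \<and> (\<Sum>v\<in>T. u v *\<^sub>R v) = x"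
proof -
  define R where "R T \<longleftrightarrow> finite T \<and> T \<subseteq> S \<and>
    (\<exists>u. (\<forall>v\<in>T. 0 \<le> u v) \<and> sum u T = 1 \<and> (\<Sum>v\<in>T. u v *\<^sub>R v) = x)" for T
  obtain T0 where "R T0"
    using assms(3) unfolding convex_hull_explicit R_def by blast
  then obtain T where RT: "R T" and min: "\<And>T'. R T' \<Longrightarrow> card T \<le> card T'"
    using exists_least_iff[of "\<lambda>n. \<exists>T. R T \<and> card T = n"] by (metis not_le)
  then obtain u where T: "finite T" "T \<subseteq> S" and u: "\<And>v. v \<in> T \<Longrightarrow> 0 \<le> u v" "sum u T = 1" "(\<Sum>v\<in>T. u v *\<^sub>R v) = x"
    by (auto simp: R_def)
  have "card T \<le> card B + 1"
  proof (rule ccontr)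
    assume "\<not> ?thesis"
    then obtain a where a: "\<exists>v\<in>T. 0 < a v" "sum a T = 0" "(\<Sum>v\<in>T. a v *\<^sub>R v) = 0"
      using exists_affine_dependency[of T B "\<lambda>v. v"] T assms by auto
    define P where "P = {v\<in>T. 0 < a v}"
    have P: "finite P" "P \<noteq> {}" using a(1) T by (auto simp: P_def)
    \<comment> \<open>The smallest ratio \<open>u w / a w\<close> is the largest multiple of
      \<open>a\<close> that can be subtracted with all weights staying nonnegative; it removes
      \<open>w\<close>.\<close>
    obtain w where w: "w \<in> P" and wmin: "\<And>v. v \<in> P \<Longrightarrow> u w / a w \<le> u v / a v"
      using arg_min_if_finite[OF P, of "\<lambda>v. u v / a v"]
      by (metis linorder_not_less)
    define t where "t = u w / a w"
    have t: "t \<ge> 0" using w u(1) by (auto simp: t_def P_def)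
    define u' where "u' v = u v - t * a v" for v
    have u'w: "u' w = 0" and wT: "w \<in> T" using w by (auto simp: u'_def t_def P_def)
    have "0 \<le> u' v" if v: "v \<in> T" for v
    proof (cases "v \<in> P")
      case True
      then show ?thesis using wmin[OF True] by (auto simp: u'_def t_def[symmetric] P_def field_simps)
    next
      case False
      then have "t * a v \<le> 0" using v t by (auto simp: P_def mult_nonneg_nonpos)
      then show ?thesis using u(1)[OF v] by (simp add: u'_def)
    qed
    moreover have "sum u' T = 1"
      using u(2) a(2) by (simp add: u'_def sum_subtractf sum_distrib_left[symmetric])
    moreover have "(\<Sum>v\<in>T. u' v *\<^sub>R v) = x"
      using u(3) a(3) by (simp add: u'_def scaleR_diff_left sum_subtractf scaleR_scaleR[symmetric] scaleR_sum_right[symmetric] del: scaleR_scaleR)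
    ultimately have "R (T - {w})"
      unfolding R_def using T u'w wT by (intro conjI exI[of _ u']) (auto simp: sum.remove[of T w])
    then have "card T \<le> card (T - {w})" by (rule min)
    then show False using card_Diff1_less[OF T(1) wT] by simp
  qed
  with T u show ?thesis by blast
qed

text \<open>The \<open>LEAST\<close> in \<open>caratheodory_number\<close> is attained once some
  bound exists, and \<open>card B + 1\<close> is one.\<close>

lemma caratheodory_number_representation:
  fixes S :: "'a::real_vector set"
  assumes "finite B" "S \<subseteq> span B" "x \<in> convex hull S"
  shows "\<exists>T u. finite T \<and> T \<subseteq> S \<and> card T \<le> caratheodory_number S \<and>
    (\<forall>v\<in>T. 0 \<le> u v) \<and> sum u T = 1 \<and> (\<Sum>v\<in>T. u v *\<^sub>R v) = x"
proof -
  have "\<forall>x\<in>convex hull S. \<exists>T u. finite T \<and> T \<subseteq> S \<and> card T \<le> caratheodory_number S \<and>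
    (\<forall>v\<in>T. 0 \<le> u v) \<and> sum u T = 1 \<and> (\<Sum>v\<in>T. u v *\<^sub>R v) = x"
    unfolding caratheodory_number_def
    by (rule LeastI[where k = "card B + 1"]) (use caratheodory_span assms in blast)
  with assms(3) show ?thesis by blast
qed

section \<open>Polynomials and their zero sets\<close>

lemma total_degree_eq_0_iff: "total_degree \<alpha> = 0 \<longleftrightarrow> \<alpha> = 0"
  by (auto simp: total_degree_def poly_mapping_eq_iff fun_eq_iff)

lemma eval_monomial_0 [simp]: "eval_monomial 0 x = 1"
  by (simp add: eval_monomial_def)

lemma eval_poly_eq_sum:
  assumes "finite A" "Poly_Mapping.keys P \<subseteq> A"
  shows "eval_poly P x = (\<Sum>\<alpha>\<in>A. Poly_Mapping.lookup P \<alpha> * eval_monomial \<alpha> x)"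
  unfolding eval_poly_def using assms
  by (intro sum.mono_neutral_left) (auto simp: in_keys_iff)

lemma continuous_on_eval_poly [continuous_intros]:
  "continuous_on S f \<Longrightarrow> continuous_on S (\<lambda>x. eval_poly P (f x))"
  unfolding eval_poly_def eval_monomial_def by (intro continuous_intros)

lemma borel_measurable_eval_poly [measurable]: "eval_poly P \<in> borel_measurable borel"
  by (rule borel_measurable_continuous_onI) (intro continuous_intros)

section \<open>Number and linear independence of the monomials\<close>

lemma card_total_degree_le:
  "card {\<alpha> :: 'i::finite \<Rightarrow>\<^sub>0 nat. total_degree \<alpha> \<le> D} \<le> (CARD('i) + D) choose CARD('i)"
proof -
  obtain xs :: "'i list" where xs: "set xs = UNIV" "distinct xs"
    using finite_distinct_list[of "UNIV :: 'i set"] by auto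
  have len: "length xs = CARD('i)" using xs distinct_card by fastforce
  define L where "L = {l::nat list. length l = CARD('i) + 1 \<and> sum_list l = D}"
  \<comment> \<open>Stars and bars: the missing degree becomes an additional first entry, which
    turns the bound on the degree into a fixed sum \<open>D\<close>.\<close>
  define f where "f \<alpha> = (D - total_degree \<alpha>) # map (Poly_Mapping.lookup \<alpha>) xs" for \<alpha> :: "'i \<Rightarrow>\<^sub>0 nat"
  have "sum_list (map (Poly_Mapping.lookup \<alpha>) xs) = total_degree \<alpha>" for \<alpha> :: "'i \<Rightarrow>\<^sub>0 nat"
    using xs by (simp add: sum_list_distinct_conv_sum_set total_degree_def)
  then have "f ` {\<alpha>. total_degree \<alpha> \<le> D} \<subseteq> L"
    by (auto simp: f_def L_def len)
  moreover have "inj_on f {\<alpha>. total_degree \<alpha> \<le> D}"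
    using xs by (auto simp: inj_on_def f_def poly_mapping_eq_iff fun_eq_iff)
  moreover have "finite L"
  proof (rule finite_subset)
    show "L \<subseteq> {l. set l \<subseteq> {..D} \<and> length l = CARD('i) + 1}"
      using member_le_sum_list by (fastforce simp: L_def)
  qed (rule finite_lists_length_eq, simp)
  ultimately have "card {\<alpha> :: 'i \<Rightarrow>\<^sub>0 nat. total_degree \<alpha> \<le> D} \<le> card L"
    by (metis card_image card_mono)
  also have "card L = (D + CARD('i)) choose D"
    unfolding L_def card_length_sum_list by simp
  also have "\<dots> = (CARD('i) + D) choose CARD('i)"
    by (metis add.commute add_diff_cancel_left' binomial_symmetric le_add1)
  finally show ?thesis .
qed

text \<open>Induction on the variables, comparing coefficients in one variable at a time. Exponents
  are functions on the whole type, hence the assumption that their restrictions to \<open>I\<close>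
  tell them apart.\<close>

lemma monomials_independent:
  fixes c :: "('i \<Rightarrow> nat) \<Rightarrow> real"
  assumes "finite I" "finite A" "inj_on (\<lambda>\<alpha>. restrict \<alpha> I) A"
    and "\<And>x. (\<Sum>\<alpha>\<in>A. c \<alpha> * (\<Prod>i\<in>I. x i ^ \<alpha> i)) = 0" "\<alpha> \<in> A"
  shows "c \<alpha> = 0"
  using assms
proof (induction I arbitrary: A \<alpha>)
  case empty
  then have "A = {\<alpha>}" by (auto simp: inj_on_def)
  with empty.prems(3) show ?case by simp
next
  case (insert i I)
  define A' where "A' = {\<beta>\<in>A. \<beta> i = \<alpha> i}"
  show ?case
  proof (rule insert.IH[of A'])
    show "inj_on (\<lambda>\<alpha>. restrict \<alpha> I) A'"
    proof (rule inj_onI)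
      fix \<beta> \<gamma> assume *: "\<beta> \<in> A'" "\<gamma> \<in> A'" "restrict \<beta> I = restrict \<gamma> I"
      then have "\<beta> j = \<gamma> j" if "j \<in> insert i I" for j
        using that by (auto simp: A'_def dest: fun_cong[of _ _ j])
      then have "restrict \<beta> (insert i I) = restrict \<gamma> (insert i I)"
        by (auto simp: restrict_def)
      moreover have "\<beta> \<in> A" "\<gamma> \<in> A" using * by (simp_all add: A'_def)
      ultimately show "\<beta> = \<gamma>" by (rule inj_onD[OF insert.prems(2)])
    qed
    fix x :: "'i \<Rightarrow> real"
    \<comment> \<open>With the variables in \<open>I\<close> frozen, the sum is a univariate
      polynomial in variable \<open>i\<close>; it vanishes everywhere, and its coefficient at
      \<open>\<alpha> i\<close> is the sum over \<open>A'\<close>.\<close>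
    define q where "q = (\<Sum>\<beta>\<in>A. monom (c \<beta> * (\<Prod>j\<in>I. x j ^ \<beta> j)) (\<beta> i))"
    have "poly q t = 0" for t
    proof -
      have "poly q t = (\<Sum>\<beta>\<in>A. c \<beta> * (\<Prod>j\<in>insert i I. (x(i := t)) j ^ \<beta> j))"
        unfolding q_def poly_sum poly_monom
      proof (intro sum.cong refl)
        fix \<beta>
        have "(\<Prod>j\<in>I. (x(i := t)) j ^ \<beta> j) = (\<Prod>j\<in>I. x j ^ \<beta> j)"
          using insert.hyps by (intro prod.cong) auto
        then show "c \<beta> * (\<Prod>j\<in>I. x j ^ \<beta> j) * t ^ \<beta> i = c \<beta> * (\<Prod>j\<in>insert i I. (x(i := t)) j ^ \<beta> j)"
          using insert.hyps by simp
      qed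
      also have "\<dots> = 0" by (rule insert.prems(3))
      finally show ?thesis .
    qed
    then have "q = 0" by (simp add: poly_all_0_iff_0[symmetric])
    then have "coeff q (\<alpha> i) = 0" by simp
    then show "(\<Sum>\<beta>\<in>A'. c \<beta> * (\<Prod>j\<in>I. x j ^ \<beta> j)) = 0"
      using insert.prems(1) by (simp add: q_def coeff_sum A'_def sum.inter_filter cong: if_cong)
  qed (use insert.prems in \<open>auto simp: A'_def\<close>)
qed

lemma eval_poly_nonzero:
  assumes "P \<noteq> 0"
  shows "\<exists>x. eval_poly P x \<noteq> 0"
proof (rule ccontr)
  assume "\<not> ?thesis"
  then have z: "eval_poly P x = 0" for x by blast
  define A where "A = Poly_Mapping.lookup ` Poly_Mapping.keys P"
  have inj: "inj_on Poly_Mapping.lookup S" for S :: "('a \<Rightarrow>\<^sub>0 nat) set"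
    by (simp add: inj_on_def poly_mapping.lookup_inject)
  have "Poly_Mapping.lookup P \<alpha> = 0" if "\<alpha> \<in> Poly_Mapping.keys P" for \<alpha>
  proof -
    have "Poly_Mapping.lookup P (Poly_Mapping.Abs_poly_mapping (Poly_Mapping.lookup \<alpha>)) = 0"
    \<comment> \<open>\<open>Abs_poly_mapping\<close> converts exponent functions back to the
      finitely supported maps that index the coefficients of \<open>P\<close>.\<close>
    proof (rule monomials_independent[of UNIV A "\<lambda>\<alpha>. Poly_Mapping.lookup P (Poly_Mapping.Abs_poly_mapping \<alpha>)"])
      fix x :: "'a \<Rightarrow> real"
      show "(\<Sum>\<alpha>\<in>A. Poly_Mapping.lookup P (Poly_Mapping.Abs_poly_mapping \<alpha>) * (\<Prod>i\<in>UNIV. x i ^ \<alpha> i)) = 0"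
        using z[of "\<chi> i. x i"] by (simp add: A_def sum.reindex[OF inj] eval_poly_def eval_monomial_def Poly_Mapping.lookup_inverse)
    qed (use that in \<open>auto simp: A_def inj_on_def poly_mapping.lookup_inject restrict_UNIV\<close>)
    then show ?thesis by (simp add: Poly_Mapping.lookup_inverse)
  qed
  then have "P = 0" by (auto simp: in_keys_iff poly_mapping_eq_iff fun_eq_iff)
  with assms show False by simp
qed

section \<open>Zero sets of nonzero polynomials are Lebesgue null\<close>

lemma eval_poly_line:
  "\<exists>q. \<forall>t. poly q t = eval_poly P (a + t *\<^sub>R y)"
proof -
  have "poly (\<Sum>\<alpha>\<in>Poly_Mapping.keys P. smult (Poly_Mapping.lookup P \<alpha>)
      (\<Prod>i\<in>UNIV. [:a $ i, y $ i:] ^ Poly_Mapping.lookup \<alpha> i)) t = eval_poly P (a + t *\<^sub>R y)" for t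
    by (simp add: eval_poly_def eval_monomial_def poly_sum poly_prod mult.commute)
  then show ?thesis by blast
qed

text \<open>Every line through a point \<open>a\<close> with \<open>P a \<noteq> 0\<close> contains finitely many zeros, so each point
  lies in only finitely many of infinitely many dilations of the zero set about \<open>a\<close>, and a bounded
  part of positive measure would contradict this.\<close>

lemma null_sets_eval_poly:
  fixes P :: "('n::finite \<Rightarrow>\<^sub>0 nat) \<Rightarrow>\<^sub>0 real"
  assumes "P \<noteq> 0"
  shows "{x. eval_poly P x = 0} \<in> null_sets lborel"
proof -
  obtain a where a: "eval_poly P a \<noteq> 0" using eval_poly_nonzero[OF assms] by blast
  have "{x \<in> ball a R. eval_poly P x = 0} \<in> null_sets lborel" for R
  proof -
    define Z where "Z = {x \<in> ball a R. eval_poly P x = 0}"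
    \<comment> \<open>Distinct dilation factors in (1, 2]: above 1 they do not shrink volumes, and
      up to 2 they keep all dilates of \<open>Z\<close> inside the ball of radius
      \<open>2 * R\<close>.\<close>
    define s :: "nat \<Rightarrow> real" where "s j = 1 + 1 / (real j + 1)" for j
    have s: "1 < s j" "s j \<le> 2" for j by (auto simp: s_def)
    define T where "T j = {x \<in> ball a (2 * R). eval_poly P (a + (1 / s j) *\<^sub>R (x - a)) = 0}" for j
    \<comment> \<open>Tail unions: a point lies in all \<open>A k\<close> exactly if it lies in
      infinitely many \<open>T j\<close>.\<close>
    define A where "A k = (\<Union>j\<in>{k..}. T j)" for k
    have "closed {x. eval_poly P x = 0}"
      by (intro closed_Collect_eq continuous_intros)
    then have Z_borel [measurable]: "Z \<in> sets borel"
      by (auto simp: Z_def Collect_conj_eq)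
    have T_borel: "T j \<in> sets borel" for j
    proof -
      have "closed {x. eval_poly P (a + (1 / s j) *\<^sub>R (x - a)) = 0}"
        by (intro closed_Collect_eq continuous_intros)
      then have "ball a (2 * R) \<inter> {x. eval_poly P (a + (1 / s j) *\<^sub>R (x - a)) = 0} \<in> sets borel"
        by auto
      then show ?thesis by (simp add: T_def Collect_conj_eq)
    qed
    have A_lm: "A k \<in> lmeasurable" for k
    proof (rule fmeasurableI2[of "ball a (2 * R)"])
      show "A k \<in> sets lebesgue" unfolding A_def
        using T_borel by (intro sets.countable_UN) auto
    qed (auto simp: A_def T_def)
    have sub: "(\<lambda>x. s j *\<^sub>R x + (1 - s j) *\<^sub>R a) ` Z \<subseteq> T j" for j
    proof safe
      fix x assume x: "x \<in> Z"
      have eq: "s j *\<^sub>R x + (1 - s j) *\<^sub>R a - a = s j *\<^sub>R (x - a)" by (simp add: algebra_simps)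
      have "s j * norm (x - a) \<le> 2 * norm (x - a)"
        using s by (intro mult_right_mono) auto
      also have "\<dots> < 2 * R" using x by (simp add: Z_def dist_norm norm_minus_commute)
      finally have "norm (s j *\<^sub>R x + (1 - s j) *\<^sub>R a - a) < 2 * R"
        unfolding eq using s(1)[of j] by simp
      moreover have "a + (1 / s j) *\<^sub>R (s j *\<^sub>R x + (1 - s j) *\<^sub>R a - a) = x"
        unfolding eq using s(1)[of j] by simp
      ultimately show "s j *\<^sub>R x + (1 - s j) *\<^sub>R a \<in> T j"
        using x by (simp add: T_def Z_def dist_norm norm_minus_commute)
    qed
    have "measure lebesgue Z \<le> measure lebesgue (A k)" for k
    proof -
      have im: "(\<lambda>x. s k *\<^sub>R x + (1 - s k) *\<^sub>R a) ` Z \<subseteq> A k"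
        using sub[of k] by (auto simp: A_def)
      have "1 * measure lebesgue Z \<le> \<bar>s k\<bar> ^ DIM(real^'n) * measure lebesgue Z"
        using s(1)[of k] by (intro mult_right_mono one_le_power) auto
      also have "\<dots> = measure lebesgue ((\<lambda>x. s k *\<^sub>R x + (1 - s k) *\<^sub>R a) ` Z)"
        by (simp only: measure_lebesgue_affine)
      also have "\<dots> \<le> measure lebesgue (A k)"
      proof (rule measure_mono_fmeasurable[OF im _ A_lm])
        have "(\<lambda>x. s k *\<^sub>R x + (1 - s k) *\<^sub>R a) ` Z
          = {x. (1 / s k) *\<^sub>R (x - (1 - s k) *\<^sub>R a) \<in> Z}"
          using s(1)[of k] by (force simp: image_iff)
        also have "\<dots> \<in> sets borel" by measurable
        finally show "(\<lambda>x. s k *\<^sub>R x + (1 - s k) *\<^sub>R a) ` Z \<in> sets lebesgue" by simp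
      qed
      finally show ?thesis by simp
    qed
    moreover have "(\<lambda>k. measure lebesgue (A k)) \<longlonglongrightarrow> measure lebesgue (\<Inter>k. A k)"
    proof (rule Lim_measure_decseq)
      show "range A \<subseteq> sets lebesgue" using A_lm by (auto dest: fmeasurableD)
      show "decseq A" by (fastforce simp: decseq_def A_def)
      show "emeasure lebesgue (A i) \<noteq> \<infinity>" for i
        using fmeasurableD2[OF A_lm] by auto
    qed
    \<comment> \<open>On the line from \<open>a\<close> through such an x, \<open>P\<close> would
      vanish at the infinitely many parameters \<open>1 / s j\<close>, hence identically, contrary
      to its value at \<open>a\<close>.\<close>
    moreover have "(\<Inter>k. A k) = {}"
    proof (rule ccontr)
      assume "(\<Inter>k. A k) \<noteq> {}"
      then obtain x where x: "\<And>k. x \<in> A k" by blast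
      define J where "J = {j. x \<in> T j}"
      have "infinite J"
        unfolding infinite_nat_iff_unbounded_le J_def using x by (fastforce simp: A_def)
      obtain q where q: "\<And>t. poly q t = eval_poly P (a + t *\<^sub>R (x - a))"
        using eval_poly_line by blast
      have "inj_on (\<lambda>j. 1 / s j) J" by (auto simp: inj_on_def s_def)
      then have "infinite ((\<lambda>j. 1 / s j) ` J)" using \<open>infinite J\<close> by (simp add: finite_image_iff)
      moreover have "(\<lambda>j. 1 / s j) ` J \<subseteq> {t. poly q t = 0}"
        by (auto simp: J_def T_def q)
      ultimately have "q = 0" using poly_roots_finite finite_subset by blast
      then show False using q[of 0] a by simp
    qed
    ultimately have "measure lebesgue Z \<le> 0"
      by (metis LIMSEQ_le_const measure_empty)
    moreover have "Z \<in> lmeasurable"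
      by (rule fmeasurableI2[of "ball a R"]) (use Z_borel in \<open>auto simp: Z_def\<close>)
    ultimately have "emeasure lebesgue Z = 0"
      by (simp add: emeasure_eq_measure2 measure_le_0_iff)
    then show ?thesis
      unfolding Z_def[symmetric] using Z_borel by (simp add: null_sets_def)
  qed
  then have "(\<Union>k::nat. {x \<in> ball a (real k). eval_poly P x = 0}) \<in> null_sets lborel"
    by (intro null_sets_UN) auto
  moreover have "(\<Union>k::nat. {x \<in> ball a (real k). eval_poly P x = 0}) = {x. eval_poly P x = 0}"
    using reals_Archimedean2 by auto
  ultimately show ?thesis by simp
qed

section \<open>Centerpoints\<close>

text \<open>Union bound: at most m complements, each of measure below 1/m, cannot cover the
  space.\<close>

lemma (in prob_space) exists_common_point:
  assumes "finite \<F>" "\<F> \<subseteq> events" "card \<F> \<le> m" "\<And>S. S \<in> \<F> \<Longrightarrow> prob S > 1 - 1 / real m"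
  shows "\<exists>x\<in>space M. \<forall>S\<in>\<F>. x \<in> S"
proof (cases "\<F> = {}")
  case True
  then show ?thesis using not_empty by auto
next
  case False
  have "prob (\<Union>S\<in>\<F>. space M - S) \<le> (\<Sum>S\<in>\<F>. prob (space M - S))"
    using assms(1,2) by (intro finite_measure_subadditive_finite) auto
  also have "\<dots> < (\<Sum>S\<in>\<F>. 1 / real m)"
  proof (rule sum_strict_mono)
    fix S assume "S \<in> \<F>"
    then have "S \<in> events" "prob S > 1 - 1 / real m" using assms by auto
    then show "prob (space M - S) < 1 / real m" by (simp add: prob_compl)
  qed (use assms False in auto)
  also have "\<dots> \<le> 1"
    using assms(3) by (cases "m = 0") (simp_all add: divide_le_eq_1)
  finally have "prob (\<Union>S\<in>\<F>. space M - S) < prob (space M)" by (simp add: prob_space)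
  then have "(\<Union>S\<in>\<F>. space M - S) \<noteq> space M" by force
  then show ?thesis by blast
qed

section \<open>Polynomials as affine functionals on the Veronese space\<close>

definition nonconstant_part :: "(('i::finite \<Rightarrow>\<^sub>0 nat) \<Rightarrow>\<^sub>0 real) \<Rightarrow> (('i \<Rightarrow>\<^sub>0 nat) \<Rightarrow>\<^sub>0 real) \<Rightarrow> real"
  where "nonconstant_part P w =
    (\<Sum>\<alpha>\<in>Poly_Mapping.keys P - {0}. Poly_Mapping.lookup P \<alpha> * Poly_Mapping.lookup w \<alpha>)"

lemma lookup_scaleR [simp]: "Poly_Mapping.lookup (c *\<^sub>R w) \<alpha> = c * Poly_Mapping.lookup w \<alpha>"
  for w :: "'a \<Rightarrow>\<^sub>0 real"
  by (simp add: scaleR_poly_mapping_def Poly_Mapping.map.rep_eq when_def)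

lemma linear_nonconstant_part: "linear (nonconstant_part P)"
  by (rule linearI)
    (simp_all add: nonconstant_part_def lookup_add algebra_simps sum.distrib sum_distrib_left)

lemma eval_poly_veronese_map:
  assumes "P \<in> Poly D"
  shows "eval_poly P x = Poly_Mapping.lookup P 0 + nonconstant_part P (veronese_map D x)"
proof -
  have "nonconstant_part P (veronese_map D x)
    = (\<Sum>\<alpha>\<in>Poly_Mapping.keys P - {0}. Poly_Mapping.lookup P \<alpha> * eval_monomial \<alpha> x)"
    unfolding nonconstant_part_def using assms
    by (intro sum.cong) (auto simp: lookup_veronese_map Poly_def total_degree_eq_0_iff Suc_le_eq)
  moreover have "eval_poly P x = (\<Sum>\<alpha>\<in>insert 0 (Poly_Mapping.keys P). Poly_Mapping.lookup P \<alpha> * eval_monomial \<alpha> x)"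
    by (rule eval_poly_eq_sum) auto
  ultimately show ?thesis by (simp add: sum.insert_remove)
qed

text \<open>For weights of sum 1, the mean of \<open>P\<close> depends only on the combined point in
  the Veronese space. This allows one set of points to be exchanged for another with the same
  combined point.\<close>

lemma affine_combination_eval_poly:
  assumes "P \<in> Poly D" "sum u A = 1"
  shows "(\<Sum>j\<in>A. u j * eval_poly P (x j))
    = Poly_Mapping.lookup P 0 + nonconstant_part P (\<Sum>j\<in>A. u j *\<^sub>R veronese_map D (x j))"
  using assms(2)
  by (simp add: eval_poly_veronese_map[OF assms(1)] linear_sum[OF linear_nonconstant_part]
      linear_cmul[OF linear_nonconstant_part] distrib_left sum.distrib sum_distrib_right[symmetric])

lemma poly_mapping_in_span_single:
  fixes w :: "'a \<Rightarrow>\<^sub>0 real"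
  assumes "finite A" "Poly_Mapping.keys w \<subseteq> A"
  shows "w \<in> span ((\<lambda>\<alpha>. Poly_Mapping.single \<alpha> 1) ` A)"
proof -
  have "w = (\<Sum>\<alpha>\<in>A. Poly_Mapping.lookup w \<alpha> *\<^sub>R Poly_Mapping.single \<alpha> 1)"
    using assms by (auto simp: poly_mapping_eq_iff fun_eq_iff lookup_sum lookup_single when_def in_keys_iff
        if_distrib[of "\<lambda>x. _ * x"] cong: if_cong)
  also have "\<dots> \<in> span ((\<lambda>\<alpha>. Poly_Mapping.single \<alpha> 1) ` A)"
    by (intro span_sum span_scale span_base) auto
  finally show ?thesis .
qed

lemma veronese_variety_subset_span:
  "veronese_variety D \<subseteq> span ((\<lambda>\<alpha>. Poly_Mapping.single \<alpha> 1) ` {\<alpha>. 1 \<le> total_degree \<alpha> \<and> total_degree \<alpha> \<le> D})"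
  unfolding veronese_variety_def
proof (safe intro!: poly_mapping_in_span_single)
  show "finite {\<alpha> :: 'a \<Rightarrow>\<^sub>0 nat. 1 \<le> total_degree \<alpha> \<and> total_degree \<alpha> \<le> D}"
    by (rule finite_subset[OF _ finite_total_degree_le[of D]]) auto
qed (auto simp: in_keys_iff lookup_veronese_map split: if_splits)

lemma veronese_cone_subset_span:
  "veronese_cone D \<subseteq> span ((\<lambda>\<alpha>. Poly_Mapping.single \<alpha> 1) ` {\<alpha>. total_degree \<alpha> = D})"
  unfolding veronese_cone_def
proof (safe intro!: poly_mapping_in_span_single)
  show "finite {\<alpha> :: 'a \<Rightarrow>\<^sub>0 nat. total_degree \<alpha> = D}"
    by (rule finite_subset[OF _ finite_total_degree_le[of D]]) auto
qed (auto simp: in_keys_iff lookup_veronese_cone_map split: if_splits)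

text \<open>Choosing one preimage for each point used makes \<open>f\<close> injective on
  \<open>X\<close>, so the weights can be pulled back.\<close>

lemma convex_hull_image_explicit:
  assumes "w \<in> convex hull (f ` S)"
  shows "\<exists>X u. finite X \<and> X \<subseteq> S \<and> (\<forall>x\<in>X. 0 \<le> u x) \<and> sum u X = 1 \<and> (\<Sum>x\<in>X. u x *\<^sub>R f x) = w"
proof -
  obtain T u where T: "finite T" "T \<subseteq> f ` S" "\<forall>v\<in>T. 0 \<le> u v" "sum u T = 1" "(\<Sum>v\<in>T. u v *\<^sub>R v) = w"
    using assms unfolding convex_hull_explicit by blast
  obtain X where X: "X \<subseteq> S" "finite X" "T = f ` X" "inj_on f X"
    using T(1,2) by (metis subset_image_inj finite_image_iff)
  show ?thesis
    using T X by (intro exI[of _ X] exI[of _ "u \<circ> f"]) (auto simp: sum.reindex)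
qed

lemma compact_PiE_UNIV: "compact S \<Longrightarrow> compact (PiE UNIV (\<lambda>_. S))"
  using compactin_PiE[of "\<lambda>_. euclidean" UNIV "\<lambda>_. S"] by (simp add: euclidean_product_topology)

text \<open>The centerpoint is given by the points and weights that represent it, so that
  compactness can be applied to lists of weights and points of a ball; the finite intersection
  property comes from Helly's theorem.\<close>

lemma exists_centerpoint:
  fixes \<mu> :: "(real ^ 'n::finite) measure"
  assumes "prob_space \<mu>" "sets \<mu> = sets borel"
  shows "\<exists>X u. finite X \<and> (\<forall>x\<in>X. 0 \<le> u x) \<and> sum u X = 1 \<and>
    (\<forall>P\<in>Poly D. 1 - 1 / real ((CARD('n) + D) choose CARD('n)) < measure \<mu> {x. eval_poly P x \<ge> 0} \<longrightarrow>
      0 \<le> (\<Sum>x\<in>X. u x * eval_poly P x))"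
proof -
  interpret prob_space \<mu> by fact
  have sp: "space \<mu> = UNIV" using sets_eq_imp_space_eq[OF assms(2)] by simp
  define m where "m = (CARD('n) + D) choose CARD('n)"
  have m: "m > 0" by (simp add: m_def)
  define A where "A = {\<alpha> :: 'n \<Rightarrow>\<^sub>0 nat. 1 \<le> total_degree \<alpha> \<and> total_degree \<alpha> \<le> D}"
  have A: "finite A" "card A + 1 \<le> m"
  proof -
    have eq: "{\<alpha> :: 'n \<Rightarrow>\<^sub>0 nat. total_degree \<alpha> \<le> D} = insert 0 A"
    proof (rule set_eqI)
      show "\<alpha> \<in> {\<alpha>. total_degree \<alpha> \<le> D} \<longleftrightarrow> \<alpha> \<in> insert 0 A" for \<alpha> :: "'n \<Rightarrow>\<^sub>0 nat"
        using total_degree_eq_0_iff[of \<alpha>] by (auto simp: A_def Suc_le_eq)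
    qed
    show "finite A" using finite_total_degree_le[of D, where 'i = 'n] unfolding eq by simp
    moreover have "0 \<notin> A" by (simp add: A_def total_degree_def)
    ultimately show "card A + 1 \<le> m"
      using card_total_degree_le[of D, where 'i = 'n] unfolding eq m_def by simp
  qed
  define B :: "(('n \<Rightarrow>\<^sub>0 nat) \<Rightarrow>\<^sub>0 real) set" where "B = (\<lambda>\<alpha>. Poly_Mapping.single \<alpha> 1) ` A"
  have B: "finite B" "card B + 1 \<le> m"
    using A card_image_le[OF A(1), of "\<lambda>\<alpha>. Poly_Mapping.single \<alpha> (1::real)"] by (auto simp: B_def)
  have vB: "range (veronese_map D) \<subseteq> span B"
    using veronese_variety_subset_span unfolding B_def A_def veronese_variety_def .
  have hullB: "convex hull (veronese_map D ` S) \<subseteq> span B" for S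
    using vB by (intro hull_minimal subspace_imp_convex subspace_span) auto

  \<comment> \<open>A ball heavy enough to be counted among the superlevel sets; it bounds the
    points that are searched.\<close>
  obtain R :: nat where R: "prob (cball 0 (real R)) > 1 - 1 / real m"
  proof -
    have "(\<lambda>k. prob (cball 0 (real k))) \<longlonglongrightarrow> prob (\<Union>k. cball 0 (real k))"
      by (rule finite_Lim_measure_incseq) (auto simp: assms(2) incseq_def)
    moreover have "(\<Union>k. cball 0 (real k)) = space \<mu>"
      unfolding sp by (auto simp: real_arch_simple)
    ultimately have "(\<lambda>k. prob (cball 0 (real k))) \<longlonglongrightarrow> 1" by (simp add: prob_space)
    then have "\<forall>\<^sub>F k in sequentially. 1 - 1 / real m < prob (cball 0 (real k))"
      by (rule order_tendstoD(1)) (use m in simp)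
    then show ?thesis using that eventually_happens[of _ sequentially] by auto
  qed
  define \<P> where "\<P> = {P \<in> Poly D. 1 - 1 / real m < prob {x. eval_poly P x \<ge> 0}}"
  define k where "k = card B + 1"
  \<comment> \<open>Elements of \<open>K\<close> list weights and points, of which only the first
    \<open>k\<close> are read. \<open>F P\<close> asks that these weights sum to 1 and give
    \<open>P\<close> a nonnegative mean, a closed condition.\<close>
  define K where "K = PiE UNIV (\<lambda>_::nat. {0..1::real} \<times> cball (0 :: real ^ 'n) (real R))"
  define F where "F P = {g :: nat \<Rightarrow> real \<times> (real ^ 'n). (\<Sum>j<k. fst (g j)) = 1 \<and>
    0 \<le> (\<Sum>j<k. fst (g j) * eval_poly P (snd (g j)))}" for P
  \<comment> \<open>Membership in \<open>F 0\<close> is what later yields that the weights sum to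
    1.\<close>
  have "K \<inter> (\<Inter>P\<in>insert 0 \<P>. F P) \<noteq> {}"
  proof (rule compact_imp_fip_image)
    show "compact K" unfolding K_def by (intro compact_PiE_UNIV compact_Times) auto
    show "closed (F P)" for P
      unfolding F_def
      by (intro closed_Collect_conj closed_Collect_eq closed_Collect_le continuous_intros
          continuous_on_fst continuous_on_snd continuous_on_product_coordinates)
    fix \<Q> assume \<Q>: "finite \<Q>" "\<Q> \<subseteq> insert 0 \<P>"
    define \<F> where "\<F> = insert (cball 0 (real R)) ((\<lambda>P. {x. eval_poly P x \<ge> 0}) ` \<Q>)"
    have \<F>: "S \<in> events \<and> prob S > 1 - 1 / real m" if "S \<in> \<F>" for S
    proof -
      have "closed {x. eval_poly P x \<ge> 0}" for P :: "('n \<Rightarrow>\<^sub>0 nat) \<Rightarrow>\<^sub>0 real"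
        by (intro closed_Collect_le continuous_intros)
      then show ?thesis
        using that \<Q>(2) R m prob_space by (auto simp: \<F>_def assms(2) \<P>_def eval_poly_def sp)
    qed
    \<comment> \<open>Any \<open>card B + 1\<close>, hence at most \<open>m\<close>, of the sets
      share a point by measure, and the Veronese image of that point lies in all their
      hulls.\<close>
    have "\<exists>w. \<forall>S\<in>\<F>. w \<in> convex hull (veronese_map D ` S)"
    proof (rule helly_span[OF B(1)])
      show "finite \<F>" using \<Q> by (simp add: \<F>_def)
      fix \<J> assume \<J>: "\<J> \<subseteq> \<F>" "card \<J> \<le> card B + 1"
      have "\<exists>x\<in>space \<mu>. \<forall>S\<in>\<J>. x \<in> S"
        by (rule exists_common_point[of _ m])
          (use \<J> \<F> B finite_subset[OF \<J>(1)] \<open>finite \<F>\<close> in auto)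
      then show "\<exists>w. \<forall>S\<in>\<J>. w \<in> convex hull (veronese_map D ` S)"
        by (meson hull_inc image_eqI)
    qed (use hullB in auto)
    then obtain w where w: "\<And>S. S \<in> \<F> \<Longrightarrow> w \<in> convex hull (veronese_map D ` S)" by blast
    obtain T u where T: "finite T" "T \<subseteq> veronese_map D ` cball 0 (real R)" "card T \<le> k"
      "\<forall>v\<in>T. 0 \<le> u v" "sum u T = 1" "(\<Sum>v\<in>T. u v *\<^sub>R v) = w"
      using caratheodory_span[OF B(1) _ w[of "cball 0 (real R)"]] vB unfolding k_def \<F>_def by blast
    obtain h where h: "bij_betw h T {..<card T}"
      using finite_same_card_bij[OF T(1), of "{..<card T}"] by auto
    have "\<forall>v\<in>T. \<exists>y\<in>cball 0 (real R). veronese_map D y = v" using T(2) by blast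
    then obtain x where x: "x v \<in> cball 0 (real R)" "veronese_map D (x v) = v" if "v \<in> T" for v
      unfolding bchoice_iff by (metis (full_types))
    \<comment> \<open>The representation of \<open>w\<close> is listed by the indices below
      \<open>card T\<close> and padded with weight 0 at the origin, which belongs to the
      ball.\<close>
    define g where "g j = (if j < card T then (u (inv_into T h j), x (inv_into T h j)) else (0, 0))" for j
    have inv: "inv_into T h j \<in> T" if "j < card T" for j
      using bij_betw_imp_surj_on[OF h] that by (intro inv_into_into) auto
    have inv_h: "inv_into T h (h v) = v" "h v < card T" if "v \<in> T" for v
      using bij_betw_inv_into_left[OF h that] bij_betwE[OF h] that by auto
    have sum_g: "(\<Sum>j<k. \<phi> (fst (g j)) (snd (g j))) = (\<Sum>v\<in>T. \<phi> (u v) (x v))"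
      if "\<And>y. \<phi> 0 y = 0" for \<phi> :: "real \<Rightarrow> real ^ 'n \<Rightarrow> real"
    proof -
      have "(\<Sum>j<k. \<phi> (fst (g j)) (snd (g j))) = (\<Sum>j<card T. \<phi> (fst (g j)) (snd (g j)))"
        using T(3) that by (intro sum.mono_neutral_right) (auto simp: g_def)
      also have "\<dots> = (\<Sum>v\<in>T. \<phi> (u v) (x v))"
        by (subst sum.reindex_bij_betw[OF h, symmetric]) (simp add: g_def inv_h)
      finally show ?thesis .
    qed
    have "g \<in> K"
    proof -
      have "u v \<le> 1" if "v \<in> T" for v
        using member_le_sum[of v T u] T that by auto
      then show ?thesis
        using T(4) inv x(1) by (auto simp: K_def g_def PiE_UNIV_domain)
    qed
    moreover have "g \<in> F P" if P: "P \<in> \<Q>" for P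
    proof -
      have PD: "P \<in> Poly D" using P \<Q> by (auto simp: \<P>_def Poly_def)
      \<comment> \<open>The same \<open>w\<close> is a combination of images of points where
        \<open>P\<close> is nonnegative, so this second representation computes the same mean of
        \<open>P\<close>.\<close>
      obtain X u' where X: "finite X" "X \<subseteq> {x. eval_poly P x \<ge> 0}" "\<forall>x\<in>X. 0 \<le> u' x"
        "sum u' X = 1" "(\<Sum>x\<in>X. u' x *\<^sub>R veronese_map D x) = w"
        using convex_hull_image_explicit[OF w[of "{x. eval_poly P x \<ge> 0}"]] P by (auto simp: \<F>_def)
      have "(\<Sum>v\<in>T. u v *\<^sub>R veronese_map D (x v)) = w"
        using T(6) x(2) by simp
      then have "(\<Sum>v\<in>T. u v * eval_poly P (x v)) = (\<Sum>x\<in>X. u' x * eval_poly P x)"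
        using affine_combination_eval_poly[OF PD T(5), of x]
          affine_combination_eval_poly[OF PD X(4), of "\<lambda>x. x"] X(5) by simp
      also have "\<dots> \<ge> 0" using X by (auto intro!: sum_nonneg)
      finally show ?thesis
        using sum_g[of "\<lambda>c y. c * eval_poly P y"] sum_g[of "\<lambda>c y. c"] T(5) by (simp add: F_def)
    qed
    ultimately show "K \<inter> (\<Inter>P\<in>\<Q>. F P) \<noteq> {}" by blast
  qed
  then obtain g where g: "g \<in> K" "\<And>P. P \<in> insert 0 \<P> \<Longrightarrow> g \<in> F P" by blast
  \<comment> \<open>A point may occur at several indices; its weights are added up to obtain a set
    with one weight per point.\<close>
  define u where "u x = (\<Sum>j | j < k \<and> snd (g j) = x. fst (g j))" for x
  define X where "X = (\<lambda>j. snd (g j)) ` {..<k}"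
  have regroup: "(\<Sum>x\<in>X. u x * \<phi> x) = (\<Sum>j<k. fst (g j) * \<phi> (snd (g j)))" for \<phi>
  proof -
    have "(\<Sum>x\<in>X. u x * \<phi> x) = (\<Sum>x\<in>X. \<Sum>j | j \<in> {..<k} \<and> snd (g j) = x. fst (g j) * \<phi> (snd (g j)))"
      by (simp add: u_def sum_distrib_right)
    also have "\<dots> = (\<Sum>j<k. fst (g j) * \<phi> (snd (g j)))"
      by (rule sum.group) (auto simp: X_def)
    finally show ?thesis .
  qed
  show ?thesis
  proof (intro exI conjI ballI impI)
    show "finite X" by (simp add: X_def)
    show "0 \<le> u x" for x
      using g(1) unfolding u_def K_def by (intro sum_nonneg) (auto simp: PiE_UNIV_domain Pi_iff mem_Times_iff)
    show "sum u X = 1" using regroup[of "\<lambda>_. 1"] g(2)[of 0] by (simp add: F_def)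
    fix P assume "P \<in> Poly D" "1 - 1 / real ((CARD('n) + D) choose CARD('n)) < prob {x. 0 \<le> eval_poly P x}"
    then show "0 \<le> (\<Sum>x\<in>X. u x * eval_poly P x)"
      using regroup[of "eval_poly P"] g(2)[of P] by (simp add: F_def \<P>_def m_def)
  qed
qed

section \<open>Homogenisation and limits\<close>

lemma weighted_sum_nonneg_imp:
  fixes w \<phi> :: "'a \<Rightarrow> real"
  assumes "\<And>y. y \<in> Y \<Longrightarrow> 0 \<le> w y" "sum w Y = 1" "0 \<le> (\<Sum>y\<in>Y. w y * \<phi> y)"
  shows "\<exists>y\<in>Y. 0 \<le> \<phi> y"
proof (rule ccontr)
  assume "\<not> ?thesis"
  then have neg: "\<phi> y < 0" if "y \<in> Y" for y using that by force
  have fin: "finite Y" using assms(2) by (metis sum.infinite zero_neq_one)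
  have le: "w y * \<phi> y \<le> 0" if "y \<in> Y" for y
    using neg[OF that] assms(1)[OF that] by (simp add: mult_nonneg_nonpos)
  then have "(\<Sum>y\<in>Y. - (w y * \<phi> y)) = 0"
    using assms(3) sum_nonpos[of Y "\<lambda>y. w y * \<phi> y"] by (simp add: sum_negf)
  then have "w y * \<phi> y = 0" if "y \<in> Y" for y
    using sum_nonneg_eq_0_iff[OF fin, of "\<lambda>y. - (w y * \<phi> y)"] le that by auto
  then have "sum w Y = 0" using neg by (intro sum.neutral) force
  with assms(2) show False by simp
qed

text \<open>One preimage is chosen per vector, so the bound on the number of vectors becomes a bound
  on points of the domain. The map \<open>g\<close> accommodates the embedding of affine space into
  the cone's domain.\<close>

lemma convex_hull_range_caratheodory_number:
  fixes f :: "'a \<Rightarrow> 'b::real_vector"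
  assumes "finite B" "range f \<subseteq> span B"
    and "finite X" "\<And>x. x \<in> X \<Longrightarrow> 0 \<le> u x" "sum u X = 1"
  shows "\<exists>Z w. finite Z \<and> card Z \<le> caratheodory_number (range f) \<and> (\<forall>z\<in>Z. 0 \<le> w z) \<and>
    sum w Z = 1 \<and> (\<Sum>z\<in>Z. w z *\<^sub>R f z) = (\<Sum>x\<in>X. u x *\<^sub>R f (g x))"
proof -
  have "(\<Sum>x\<in>X. u x *\<^sub>R f (g x)) \<in> convex hull (range f)"
    by (rule convex_sum[OF assms(3) convex_convex_hull assms(5,4)]) (simp_all add: hull_inc)
  from caratheodory_number_representation[OF assms(1,2) this] obtain T w where T: "finite T" "T \<subseteq> range f" "card T \<le> caratheodory_number (range f)"
    "\<forall>v\<in>T. 0 \<le> w v" "sum w T = 1" "(\<Sum>v\<in>T. w v *\<^sub>R v) = (\<Sum>x\<in>X. u x *\<^sub>R f (g x))"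
    by blast
  then obtain Z where Z: "T = f ` Z" "inj_on f Z" by (metis subset_image_inj)
  then have "finite Z" "card Z = card T" using T(1) by (simp_all add: finite_image_iff card_image)
  then show ?thesis
    using T Z by (intro exI[of _ Z] exI[of _ "w \<circ> f"]) (auto simp: sum.reindex)
qed

lemma eval_poly_Poly:
  assumes "P \<in> Poly D"
  shows "eval_poly P x = (\<Sum>\<alpha> | total_degree \<alpha> \<le> D. Poly_Mapping.lookup P \<alpha> * eval_monomial \<alpha> x)"
  using assms by (intro eval_poly_eq_sum finite_total_degree_le) (auto simp: Poly_def)

lemma Poly_diff_const:
  assumes "P \<in> Poly D"
  shows "P - Poly_Mapping.single 0 c \<in> Poly D"
    and "eval_poly (P - Poly_Mapping.single 0 c) x = eval_poly P x - c"
proof -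
  have td: "total_degree (0 :: 'a \<Rightarrow>\<^sub>0 nat) \<le> D" by (simp add: total_degree_def)
  have "Poly_Mapping.keys (P - Poly_Mapping.single 0 c) \<subseteq> insert 0 (Poly_Mapping.keys P)"
    by (auto simp: in_keys_iff lookup_minus lookup_single when_def split: if_splits)
  then show P': "P - Poly_Mapping.single 0 c \<in> Poly D"
    using assms td by (auto simp: Poly_def)
  show "eval_poly (P - Poly_Mapping.single 0 c) x = eval_poly P x - c"
    unfolding eval_poly_Poly[OF P'] eval_poly_Poly[OF assms]
    using td finite_total_degree_le[of D, where 'i = 'a]
    by (simp add: lookup_minus left_diff_distrib sum_subtractf lookup_single when_mult when_def
        if_distrib[of "\<lambda>c. c * _"] cong: if_cong)
qed

lemma Poly_scaleR:
  assumes "P \<in> Poly D"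
  shows "c *\<^sub>R P \<in> Poly D" and "eval_poly (c *\<^sub>R P) x = c * eval_poly P x"
proof -
  show P': "c *\<^sub>R P \<in> Poly D"
    using assms by (auto simp: Poly_def in_keys_iff)
  show "eval_poly (c *\<^sub>R P) x = c * eval_poly P x"
    unfolding eval_poly_Poly[OF P'] eval_poly_Poly[OF assms] by (simp add: sum_distrib_left mult.assoc)
qed

section \<open>Homogenisation to degree \<open>D\<close>\<close>

definition homogenize :: "nat \<Rightarrow> ('n::finite \<Rightarrow>\<^sub>0 nat) \<Rightarrow> ('n option \<Rightarrow>\<^sub>0 nat)"
  where "homogenize D \<alpha> = Poly_Mapping.Abs_poly_mapping
    (\<lambda>i. case i of None \<Rightarrow> D - total_degree \<alpha> | Some j \<Rightarrow> Poly_Mapping.lookup \<alpha> j)"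

text \<open>The value at \<open>z\<close> of the degree-\<open>D\<close> homogenisation of
  \<open>P\<close>; the index \<open>None\<close> is the homogenising variable.\<close>

definition hom_eval :: "nat \<Rightarrow> (('n::finite \<Rightarrow>\<^sub>0 nat) \<Rightarrow>\<^sub>0 real) \<Rightarrow> real ^ 'n option \<Rightarrow> real"
  where "hom_eval D P z =
    (\<Sum>\<alpha> | total_degree \<alpha> \<le> D. Poly_Mapping.lookup P \<alpha> * eval_monomial (homogenize D \<alpha>) z)"

lemma lookup_homogenize:
  "Poly_Mapping.lookup (homogenize D \<alpha>) i =
    (case i of None \<Rightarrow> D - total_degree \<alpha> | Some j \<Rightarrow> Poly_Mapping.lookup \<alpha> j)"
  unfolding homogenize_def by (subst Poly_Mapping.lookup_Abs_poly_mapping) auto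

lemma total_degree_homogenize:
  assumes "total_degree \<alpha> \<le> D"
  shows "total_degree (homogenize D \<alpha>) = D"
  using assms
  by (simp add: total_degree_def lookup_homogenize UNIV_option_conv sum.reindex)

lemma eval_monomial_homogenize:
  "eval_monomial (homogenize D \<alpha>) z = (z $ None) ^ (D - total_degree \<alpha>) * eval_monomial \<alpha> (\<chi> i. z $ Some i)"
  by (simp add: eval_monomial_def lookup_homogenize UNIV_option_conv prod.reindex)

lemma eval_monomial_divide:
  "eval_monomial \<alpha> (\<chi> i. x i / c) = eval_monomial \<alpha> (\<chi> i. x i) / c ^ total_degree \<alpha>"
  by (simp add: eval_monomial_def total_degree_def power_divide prod_dividef power_sum)

text \<open>Dehomogenisation away from the hyperplane at infinity. For even \<open>D\<close> the
  factor is positive, so signs are preserved.\<close>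

lemma hom_eval_eq:
  assumes "P \<in> Poly D" "z $ None \<noteq> 0"
  shows "hom_eval D P z = (z $ None) ^ D * eval_poly P (\<chi> i. z $ Some i / z $ None)"
  unfolding hom_eval_def eval_poly_Poly[OF assms(1)] sum_distrib_left
proof (rule sum.cong, goal_cases)
  case (2 \<alpha>)
  then have "(z $ None) ^ D = (z $ None) ^ (D - total_degree \<alpha>) * (z $ None) ^ total_degree \<alpha>"
    by (simp add: power_add[symmetric])
  then show ?case
    using assms(2) by (simp add: eval_monomial_homogenize eval_monomial_divide)
qed simp

lemma hom_eval_affine:
  assumes "P \<in> Poly D"
  shows "hom_eval D P (\<chi> i. case i of None \<Rightarrow> 1 | Some j \<Rightarrow> x $ j) = eval_poly P x"
  using hom_eval_eq[OF assms, of "\<chi> i. case i of None \<Rightarrow> 1 | Some j \<Rightarrow> x $ j"] by simp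

text \<open>Every coefficient of \<open>P\<close>, the constant one included, pairs with a
  coordinate of degree \<open>D\<close>, so the sum depends only on the combined point in the cone's
  space.\<close>

lemma sum_hom_eval:
  "(\<Sum>z\<in>Z. w z * hom_eval D P (g z)) = (\<Sum>\<alpha> | total_degree \<alpha> \<le> D.
    Poly_Mapping.lookup P \<alpha> * Poly_Mapping.lookup (\<Sum>z\<in>Z. w z *\<^sub>R veronese_cone_map D (g z)) (homogenize D \<alpha>))"
proof -
  have "(\<Sum>z\<in>Z. w z * hom_eval D P (g z)) = (\<Sum>\<alpha> | total_degree \<alpha> \<le> D. \<Sum>z\<in>Z.
    w z * (Poly_Mapping.lookup P \<alpha> * eval_monomial (homogenize D \<alpha>) (g z)))"
    unfolding hom_eval_def sum_distrib_left by (rule sum.swap)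
  also have "\<dots> = (\<Sum>\<alpha> | total_degree \<alpha> \<le> D. Poly_Mapping.lookup P \<alpha> *
    Poly_Mapping.lookup (\<Sum>z\<in>Z. w z *\<^sub>R veronese_cone_map D (g z)) (homogenize D \<alpha>))"
    by (intro sum.cong refl)
      (simp add: lookup_sum lookup_veronese_cone_map total_degree_homogenize sum_distrib_left mult_ac)
  finally show ?thesis .
qed

section \<open>Limits of normalised polynomials\<close>

lemma bounded_family_convergent_subseq:
  fixes f :: "nat \<Rightarrow> 'a \<Rightarrow> real"
  assumes "finite A" "\<And>n a. a \<in> A \<Longrightarrow> \<bar>f n a\<bar> \<le> b"
  shows "\<exists>r l. strict_mono r \<and> (\<forall>a\<in>A. (\<lambda>n. f (r n) a) \<longlonglongrightarrow> l a)"
  using assms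
proof (induction A rule: finite_induct)
  case empty
  then show ?case using strict_mono_id by auto
next
  case (insert a A)
  then obtain r l where r: "strict_mono r" "\<forall>a\<in>A. (\<lambda>n. f (r n) a) \<longlonglongrightarrow> l a" by auto
  have "bounded (range (\<lambda>n. f (r n) a))"
    unfolding bounded_iff using insert.prems by auto
  then obtain c s where s: "strict_mono s" "((\<lambda>n. f (r n) a) \<circ> s) \<longlonglongrightarrow> c"
    using bounded_imp_convergent_subsequence by blast
  have "(\<lambda>n. f ((r \<circ> s) n) x) \<longlonglongrightarrow> (l(a := c)) x" if "x \<in> insert a A" for x
  proof (cases "x = a")
    case True
    then show ?thesis using s(2) by (simp add: o_def)
  next
    case False
    then show ?thesis
      using LIMSEQ_subseq_LIMSEQ[OF _ s(1), of "\<lambda>n. f (r n) x" "l x"] r(2) that by (auto simp: o_def)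
  qed
  then show ?case using strict_mono_o[OF r(1) s(1)] by blast
qed

text \<open>Compactness of the unit sphere for the sum of absolute coefficients: the limit still has
  norm 1 and is therefore nonzero.\<close>

lemma Poly_convergent_subseq:
  fixes P :: "nat \<Rightarrow> ('n::finite \<Rightarrow>\<^sub>0 nat) \<Rightarrow>\<^sub>0 real"
  assumes "\<And>n. P n \<in> Poly D" "\<And>n. (\<Sum>\<alpha> | total_degree \<alpha> \<le> D. \<bar>Poly_Mapping.lookup (P n) \<alpha>\<bar>) = 1"
  shows "\<exists>r Q. strict_mono r \<and> Q \<in> Poly D \<and> Q \<noteq> 0 \<and>
    (\<forall>\<alpha>. total_degree \<alpha> \<le> D \<longrightarrow> (\<lambda>n. Poly_Mapping.lookup (P (r n)) \<alpha>) \<longlonglongrightarrow> Poly_Mapping.lookup Q \<alpha>)"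
proof -
  define A where "A = {\<alpha> :: 'n \<Rightarrow>\<^sub>0 nat. total_degree \<alpha> \<le> D}"
  have A: "finite A" unfolding A_def by (rule finite_total_degree_le)
  have sum1: "(\<Sum>\<alpha>\<in>A. \<bar>Poly_Mapping.lookup (P n) \<alpha>\<bar>) = 1" for n using assms(2) by (simp add: A_def)
  have "\<bar>Poly_Mapping.lookup (P n) \<alpha>\<bar> \<le> 1" if "\<alpha> \<in> A" for n \<alpha>
    unfolding sum1[symmetric, of n] by (rule member_le_sum) (use that A in auto)
  then obtain r l where r: "strict_mono r"
    and l: "\<And>\<alpha>. \<alpha> \<in> A \<Longrightarrow> (\<lambda>n. Poly_Mapping.lookup (P (r n)) \<alpha>) \<longlonglongrightarrow> l \<alpha>"
    using bounded_family_convergent_subseq[OF A, of "\<lambda>n. Poly_Mapping.lookup (P n)"] by metis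
  define Q where "Q = (\<Sum>\<alpha>\<in>A. Poly_Mapping.single \<alpha> (l \<alpha>))"
  have Q: "Poly_Mapping.lookup Q \<alpha> = (if \<alpha> \<in> A then l \<alpha> else 0)" for \<alpha>
    using A by (simp add: Q_def lookup_sum lookup_single when_def)
  have "(\<lambda>n. \<Sum>\<alpha>\<in>A. \<bar>Poly_Mapping.lookup (P (r n)) \<alpha>\<bar>) \<longlonglongrightarrow> (\<Sum>\<alpha>\<in>A. \<bar>l \<alpha>\<bar>)"
    by (intro tendsto_intros l)
  then have "(\<Sum>\<alpha>\<in>A. \<bar>l \<alpha>\<bar>) = 1" unfolding sum1 by (simp add: LIMSEQ_const_iff)
  then have "\<exists>\<alpha>\<in>A. l \<alpha> \<noteq> 0" by (metis abs_zero sum.neutral zero_neq_one)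
  then have "Q \<noteq> 0" using Q by (metis lookup_zero)
  moreover have "Q \<in> Poly D" by (auto simp: Poly_def in_keys_iff Q A_def split: if_splits)
  ultimately show ?thesis using r l Q by (intro exI[of _ r] exI[of _ Q]) (auto simp: A_def)
qed

text \<open>Where the limit is negative, the functions are eventually negative. So the complement
  lies in the increasing union of the \<open>B k\<close>, each of measure at most
  \<open>1 - t\<close>.\<close>

lemma (in prob_space) prob_nonneg_limit:
  fixes f :: "nat \<Rightarrow> 'a \<Rightarrow> real"
  assumes [measurable]: "\<And>n. f n \<in> borel_measurable M" "g \<in> borel_measurable M"
    and "\<And>n. t \<le> prob {x\<in>space M. f n x \<ge> 0}" "\<And>x. x \<in> space M \<Longrightarrow> (\<lambda>n. f n x) \<longlonglongrightarrow> g x"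
  shows "t \<le> prob {x\<in>space M. g x \<ge> 0}"
proof -
  define B where "B k = {x\<in>space M. \<forall>n\<ge>k. f n x < 0}" for k
  have [measurable]: "B k \<in> events" for k unfolding B_def by measurable
  have "prob (B k) \<le> 1 - t" for k
  proof -
    have "prob (B k) \<le> prob (space M - {x\<in>space M. f k x \<ge> 0})"
      by (rule finite_measure_mono) (auto simp: B_def)
    also have "\<dots> \<le> 1 - t" using assms(3)[of k] by (subst prob_compl) auto
    finally show ?thesis .
  qed
  moreover have "(\<lambda>k. prob (B k)) \<longlonglongrightarrow> prob (\<Union>k. B k)"
    by (rule finite_Lim_measure_incseq) (auto simp: incseq_def B_def)
  ultimately have "prob (\<Union>k. B k) \<le> 1 - t"
    by (intro LIMSEQ_le_const2) auto
  moreover have "prob (space M - {x\<in>space M. g x \<ge> 0}) \<le> prob (\<Union>k. B k)"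
  proof (rule finite_measure_mono)
    show "space M - {x\<in>space M. g x \<ge> 0} \<subseteq> (\<Union>k. B k)"
    proof
      fix x assume x: "x \<in> space M - {x\<in>space M. g x \<ge> 0}"
      then have "\<forall>\<^sub>F n in sequentially. f n x < 0"
        using order_tendstoD(2)[OF assms(4), of x 0] by auto
      then show "x \<in> (\<Union>k. B k)" using x by (auto simp: B_def eventually_sequentially)
    qed
  qed auto
  ultimately show ?thesis by (subst (asm) prob_compl) auto
qed

section \<open>Weak nets\<close>

lemma weak_netI:
  assumes "\<And>P. P \<in> Poly D \<Longrightarrow> t < measure \<mu> {x. eval_poly P x \<ge> 0} \<Longrightarrow> \<exists>x\<in>X. 0 \<le> eval_poly P x"
  shows "weak_net t \<mu> (Poly_plus D) X"
  unfolding weak_net_def Poly_plus_def using assms by blast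

lemma weak_net_veronese_variety:
  fixes \<mu> :: "(real ^ 'n::finite) measure"
  assumes "prob_space \<mu>" "sets \<mu> = sets borel"
  shows "\<exists>X. finite X \<and>
    card X \<le> caratheodory_number (veronese_variety D :: (('n \<Rightarrow>\<^sub>0 nat) \<Rightarrow>\<^sub>0 real) set) \<and>
    weak_net (1 - 1 / real ((CARD('n) + D) choose CARD('n))) \<mu> (Poly_plus D) X"
proof -
  obtain X u where X: "finite X" "\<And>x. x \<in> X \<Longrightarrow> 0 \<le> u x" "sum u X = 1"
    and cp: "\<And>P. P \<in> Poly D \<Longrightarrow>
      1 - 1 / real ((CARD('n) + D) choose CARD('n)) < measure \<mu> {x. eval_poly P x \<ge> 0} \<Longrightarrow>
      0 \<le> (\<Sum>x\<in>X. u x * eval_poly P x)"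
    using exists_centerpoint[OF assms, of D] by blast
  define B where "B = (\<lambda>\<alpha> :: 'n \<Rightarrow>\<^sub>0 nat. Poly_Mapping.single \<alpha> (1::real)) ` {\<alpha>. 1 \<le> total_degree \<alpha> \<and> total_degree \<alpha> \<le> D}"
  have B: "finite B" unfolding B_def
    by (intro finite_imageI finite_subset[OF _ finite_total_degree_le[of D]]) auto
  have "range (veronese_map D) \<subseteq> span B"
    using veronese_variety_subset_span unfolding B_def veronese_variety_def .
  from convex_hull_range_caratheodory_number[OF B this X, of "\<lambda>x. x"]
  obtain Z w where Z: "finite Z" "card Z \<le> caratheodory_number (range (veronese_map D) :: (('n \<Rightarrow>\<^sub>0 nat) \<Rightarrow>\<^sub>0 real) set)"
    "\<forall>z\<in>Z. 0 \<le> w z" "sum w Z = 1"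
    "(\<Sum>z\<in>Z. w z *\<^sub>R veronese_map D z) = (\<Sum>x\<in>X. u x *\<^sub>R veronese_map D x)"
    by blast
  have "weak_net (1 - 1 / real ((CARD('n) + D) choose CARD('n))) \<mu> (Poly_plus D) Z"
  proof (rule weak_netI)
    fix P :: "('n \<Rightarrow>\<^sub>0 nat) \<Rightarrow>\<^sub>0 real"
    assume P: "P \<in> Poly D" "1 - 1 / real ((CARD('n) + D) choose CARD('n)) < measure \<mu> {x. eval_poly P x \<ge> 0}"
    have "(\<Sum>z\<in>Z. w z * eval_poly P z) = (\<Sum>x\<in>X. u x * eval_poly P x)"
      using affine_combination_eval_poly[OF P(1) Z(4), of "\<lambda>x. x"]
        affine_combination_eval_poly[OF P(1) X(3), of "\<lambda>x. x"] Z(5) by simp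
    then have "0 \<le> (\<Sum>z\<in>Z. w z * eval_poly P z)" using cp[OF P] by simp
    then show "\<exists>z\<in>Z. 0 \<le> eval_poly P z"
      using weighted_sum_nonneg_imp[of Z w "eval_poly P"] Z(3,4) by blast
  qed
  then show ?thesis using Z(1,2) unfolding veronese_variety_def by blast
qed

text \<open>As the zero set of \<open>Q\<close> is null, the sets where \<open>Q\<close> is at least
  1/(k+1) exhaust its superlevel set in measure. One of them is still heavier than \<open>s\<close>,
  and the centerpoint property of the shifted polynomial bounds the mean of \<open>Q\<close> away
  from 0.\<close>

lemma centerpoint_pos:
  fixes \<mu> :: "(real ^ 'n::finite) measure"
  assumes "prob_space \<mu>" "sets \<mu> = sets borel" "absolutely_continuous lborel \<mu>"
    and u: "sum u X = 1"
    and cp: "\<And>P. P \<in> Poly D \<Longrightarrow> s < measure \<mu> {x. eval_poly P x \<ge> 0} \<Longrightarrow> 0 \<le> (\<Sum>x\<in>X. u x * eval_poly P x)"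
    and Q: "Q \<in> Poly D" "Q \<noteq> 0" "s < measure \<mu> {x. eval_poly Q x \<ge> 0}"
  shows "0 < (\<Sum>x\<in>X. u x * eval_poly Q x)"
proof -
  interpret prob_space \<mu> by fact
  have sp: "space \<mu> = UNIV" using sets_eq_imp_space_eq[OF assms(2)] by simp
  have [measurable]: "eval_poly Q \<in> borel_measurable \<mu>"
    using borel_measurable_eval_poly measurable_cong_sets[OF assms(2) refl] by blast
  define E where "E k = {x\<in>space \<mu>. eval_poly Q x \<ge> 1 / real (Suc k)}" for k
  have E_sets [measurable]: "E k \<in> events" for k unfolding E_def by measurable
  have null: "{x. eval_poly Q x = 0} \<in> null_sets \<mu>"
    using null_sets_eval_poly[OF Q(2)] assms(3) by (auto simp: absolutely_continuous_def)
  have Un: "(\<Union>k. E k) = {x. eval_poly Q x > 0}"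
  proof safe
    fix x k assume "x \<in> E k"
    then have "1 / real (Suc k) \<le> eval_poly Q x" by (simp add: E_def)
    then show "0 < eval_poly Q x" by (rule less_le_trans[rotated]) simp
  next
    fix x assume "0 < eval_poly Q x"
    then obtain k where "inverse (real (Suc k)) < eval_poly Q x" using reals_Archimedean by blast
    then have "x \<in> E k" by (simp add: E_def sp inverse_eq_divide)
    then show "x \<in> (\<Union>k. E k)" by blast
  qed
  have "{x. eval_poly Q x > 0} \<in> events" unfolding Un[symmetric] by measurable
  then have "prob ({x. eval_poly Q x > 0} \<union> {x. eval_poly Q x = 0}) = prob {x. eval_poly Q x > 0}"
    using null by (rule measure_Un_null_set)
  moreover have "{x. eval_poly Q x > 0} \<union> {x. eval_poly Q x = 0} = {x. eval_poly Q x \<ge> 0}"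
    by auto
  moreover have "(\<lambda>k. prob (E k)) \<longlonglongrightarrow> prob (\<Union>k. E k)"
  proof (rule finite_Lim_measure_incseq)
    show "incseq E"
    proof (rule incseq_SucI)
      fix k
      have "1 / real (Suc (Suc k)) \<le> 1 / real (Suc k)" by (intro divide_left_mono) auto
      then show "E k \<subseteq> E (Suc k)" unfolding E_def by (auto intro: order_trans)
    qed
  qed auto
  ultimately have "\<forall>\<^sub>F k in sequentially. s < prob (E k)"
    using Q(3) Un by (intro order_tendstoD(1)) auto
  then obtain k where k: "s < prob (E k)" using eventually_happens[of _ sequentially] by auto
  define c where "c = 1 / real (Suc k)"
  have "E k = {x. eval_poly (Q - Poly_Mapping.single 0 c) x \<ge> 0}"
    by (auto simp: E_def sp c_def Poly_diff_const(2)[OF Q(1)])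
  then have "0 \<le> (\<Sum>x\<in>X. u x * (eval_poly Q x - c))"
    using cp[OF Poly_diff_const(1)[OF Q(1), of c]] k by (simp add: Poly_diff_const(2)[OF Q(1)])
  also have "\<dots> = (\<Sum>x\<in>X. u x * eval_poly Q x) - c"
    using u by (simp add: right_diff_distrib sum_subtractf sum_distrib_right[symmetric])
  finally have "c \<le> (\<Sum>x\<in>X. u x * eval_poly Q x)" by simp
  then show ?thesis by (rule less_le_trans[rotated]) (simp add: c_def)
qed

text \<open>A Caratheodory representation in the cone may contain points at infinity, which
  correspond to no point of affine space; the gap between \<open>t\<close> and 1 - 1/m pays for
  moving them.\<close>

lemma weak_net_veronese_cone:
  fixes \<mu> :: "(real ^ 'n::finite) measure"
  assumes "prob_space \<mu>" "sets \<mu> = sets borel" "absolutely_continuous lborel \<mu>" "even D"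
    and t: "1 - 1 / real ((CARD('n) + D) choose CARD('n)) < t"
  shows "\<exists>Y. finite Y \<and>
    card Y \<le> caratheodory_number (veronese_cone D :: (('n option \<Rightarrow>\<^sub>0 nat) \<Rightarrow>\<^sub>0 real) set) \<and>
    weak_net t \<mu> (Poly_plus D) Y"
proof -
  interpret prob_space \<mu> by fact
  have sp: "space \<mu> = UNIV" using sets_eq_imp_space_eq[OF assms(2)] by simp
  obtain X u where X: "finite X" "\<And>x. x \<in> X \<Longrightarrow> 0 \<le> u x" "sum u X = 1"
    and cp: "\<And>P. P \<in> Poly D \<Longrightarrow>
      1 - 1 / real ((CARD('n) + D) choose CARD('n)) < prob {x. eval_poly P x \<ge> 0} \<Longrightarrow>
      0 \<le> (\<Sum>x\<in>X. u x * eval_poly P x)"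
    using exists_centerpoint[OF assms(1,2), of D] by blast
  define B where "B = (\<lambda>\<alpha> :: 'n option \<Rightarrow>\<^sub>0 nat. Poly_Mapping.single \<alpha> (1::real)) ` {\<alpha>. total_degree \<alpha> = D}"
  have B: "finite B" unfolding B_def
    by (intro finite_imageI finite_subset[OF _ finite_total_degree_le[of D]]) auto
  have "range (veronese_cone_map D) \<subseteq> span B"
    using veronese_cone_subset_span unfolding B_def veronese_cone_def .
  \<comment> \<open>Embedding at height 1, where homogenised polynomials take their original
    values.\<close>
  define aff :: "real ^ 'n \<Rightarrow> real ^ 'n option"
    where "aff x = (\<chi> i. case i of None \<Rightarrow> 1 | Some j \<Rightarrow> x $ j)" for x
  from convex_hull_range_caratheodory_number[OF B \<open>range (veronese_cone_map D) \<subseteq> span B\<close> X, of aff]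
  obtain Z w where Z: "finite Z" "card Z \<le> caratheodory_number (veronese_cone D :: (('n option \<Rightarrow>\<^sub>0 nat) \<Rightarrow>\<^sub>0 real) set)"
    "\<forall>z\<in>Z. 0 \<le> w z" "sum w Z = 1"
    "(\<Sum>z\<in>Z. w z *\<^sub>R veronese_cone_map D z) = (\<Sum>x\<in>X. u x *\<^sub>R veronese_cone_map D (aff x))"
    unfolding veronese_cone_def by blast
  \<comment> \<open>Both weighted families have the same combined point in the cone's space, so they
    give the same mean to every homogenised polynomial.\<close>
  have transfer: "(\<Sum>z\<in>Z. w z * hom_eval D P z) = (\<Sum>x\<in>X. u x * eval_poly P x)" if "P \<in> Poly D" for P
    using sum_hom_eval[of w D P "\<lambda>z. z" Z] sum_hom_eval[of u D P aff X] Z(5)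
      hom_eval_affine[OF that] by (simp add: aff_def)
  \<comment> \<open>Points at infinity are moved to height \<open>\<epsilon>\<close>.\<close>
  define lift :: "real \<Rightarrow> real ^ 'n option \<Rightarrow> real ^ 'n option"
    where "lift \<epsilon> z = (\<chi> i. if i = None \<and> z $ None = 0 then \<epsilon> else z $ i)" for \<epsilon> z
  define Y where "Y n = (\<lambda>z. \<chi> i. lift (1 / real (Suc n)) z $ Some i / lift (1 / real (Suc n)) z $ None) ` Z" for n
  have "\<exists>n. weak_net t \<mu> (Poly_plus D) (Y n)"
  proof (rule ccontr)
    assume "\<not> ?thesis"
    then have "\<forall>n. \<exists>P. P \<in> Poly D \<and> t < prob {x. eval_poly P x \<ge> 0} \<and> (\<forall>y\<in>Y n. eval_poly P y < 0)"
      using weak_netI[of D t \<mu>] by (metis not_less)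
    then obtain P0 where P0: "\<And>n. P0 n \<in> Poly D" "\<And>n. t < prob {x. eval_poly (P0 n) x \<ge> 0}"
      "\<And>n y. y \<in> Y n \<Longrightarrow> eval_poly (P0 n) y < 0"
      by metis
    \<comment> \<open>Dividing by \<open>N n\<close> makes the counterexamples precompact without
      changing signs. It is positive because \<open>P0 n\<close> is negative on the nonempty set
      \<open>Y n\<close>.\<close>
    define N where "N n = (\<Sum>\<alpha> | total_degree \<alpha> \<le> D. \<bar>Poly_Mapping.lookup (P0 n) \<alpha>\<bar>)" for n
    have N: "N n > 0" for n
    proof (rule ccontr)
      assume "\<not> N n > 0"
      then have "N n = 0" unfolding N_def using sum_nonneg[of _ "\<lambda>\<alpha>. \<bar>Poly_Mapping.lookup (P0 n) \<alpha>\<bar>"]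
        by (metis abs_ge_zero order.order_iff_strict)
      then have "\<forall>\<alpha>. total_degree \<alpha> \<le> D \<longrightarrow> Poly_Mapping.lookup (P0 n) \<alpha> = 0"
        unfolding N_def using finite_total_degree_le[of D, where 'i = 'n]
        by (subst (asm) sum_nonneg_eq_0_iff) auto
      then have "eval_poly (P0 n) y = 0" for y
        unfolding eval_poly_Poly[OF P0(1)] by simp
      moreover have "Z \<noteq> {}" using Z(4) by auto
      ultimately show False using P0(3)[of _ n] by (auto simp: Y_def)
    qed
    define P where "P n = (1 / N n) *\<^sub>R P0 n" for n
    have P: "P n \<in> Poly D" "eval_poly (P n) x = 1 / N n * eval_poly (P0 n) x" for n x
      unfolding P_def using Poly_scaleR[OF P0(1)] by auto
    have P_norm: "(\<Sum>\<alpha> | total_degree \<alpha> \<le> D. \<bar>Poly_Mapping.lookup (P n) \<alpha>\<bar>) = 1" for n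
    proof -
      have "(\<Sum>\<alpha> | total_degree \<alpha> \<le> D. \<bar>Poly_Mapping.lookup (P n) \<alpha>\<bar>) = 1 / N n * N n"
        using N[of n] by (simp add: P_def abs_mult sum_divide_distrib[symmetric]) (simp add: N_def)
      then show ?thesis using N[of n] by simp
    qed
    have P_prob: "t \<le> prob {x. eval_poly (P n) x \<ge> 0}" for n
      using P0(2)[of n] N[of n] by (simp add: P(2) zero_le_divide_iff)
    obtain r Q where r: "strict_mono r" and Q: "Q \<in> Poly D" "Q \<noteq> 0"
      and lim: "\<And>\<alpha>. total_degree \<alpha> \<le> D \<Longrightarrow>
        (\<lambda>n. Poly_Mapping.lookup (P (r n)) \<alpha>) \<longlonglongrightarrow> Poly_Mapping.lookup Q \<alpha>"
      using Poly_convergent_subseq[of P D] P(1) P_norm by blast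
    \<comment> \<open>Strictness can be lost in the limit, but \<open>t\<close> itself lies strictly
      above 1 - 1/m, as strict positivity at the centerpoint requires.\<close>
    have "t \<le> prob {x\<in>space \<mu>. eval_poly Q x \<ge> 0}"
    proof (rule prob_nonneg_limit)
      show "eval_poly (P (r n)) \<in> borel_measurable \<mu>" "eval_poly Q \<in> borel_measurable \<mu>" for n
        using borel_measurable_eval_poly measurable_cong_sets[OF assms(2) refl] by blast+
      show "(\<lambda>n. eval_poly (P (r n)) x) \<longlonglongrightarrow> eval_poly Q x" for x
        unfolding eval_poly_Poly[OF P(1)] eval_poly_Poly[OF Q(1)]
        by (intro tendsto_intros lim) auto
    qed (simp add: sp P_prob)
    then have "0 < (\<Sum>z\<in>Z. w z * hom_eval D Q z)"
      unfolding transfer[OF Q(1)]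
      by (intro centerpoint_pos[OF assms(1-3) X(3) cp Q]) (use t in \<open>auto simp: sp\<close>)
    moreover have "(\<Sum>z\<in>Z. w z * hom_eval D Q z) \<le> 0"
    proof (rule LIMSEQ_le_const2)
      \<comment> \<open>The height follows the subsequence, so that \<open>lift (e n) z\<close>
        projects to a point of \<open>Y (r n)\<close>, where \<open>P (r n)\<close> is
        negative.\<close>
      define e where "e n = 1 / real (Suc (r n))" for n
      have "e \<longlonglongrightarrow> 0"
        unfolding e_def using LIMSEQ_subseq_LIMSEQ[OF LIMSEQ_inverse_real_of_nat r]
        by (simp add: o_def inverse_eq_divide)
      then have "(\<lambda>n. lift (e n) z $ i) \<longlonglongrightarrow> z $ i" for z i
        by (cases "i = None \<and> z $ None = 0") (auto simp: lift_def)
      then have "(\<lambda>n. lift (e n) z) \<longlonglongrightarrow> z" for z by (rule vec_tendstoI)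
      then show "(\<lambda>n. \<Sum>z\<in>Z. w z * hom_eval D (P (r n)) (lift (e n) z)) \<longlonglongrightarrow> (\<Sum>z\<in>Z. w z * hom_eval D Q z)"
        unfolding hom_eval_def eval_monomial_def by (intro tendsto_intros lim) auto
      \<comment> \<open>Evenness of \<open>D\<close> keeps the homogenising factor nonnegative also
        for points of negative height.\<close>
      have "w z * hom_eval D (P (r n)) (lift (e n) z) \<le> 0" if z: "z \<in> Z" for n z
      proof -
        have nz: "lift (e n) z $ None \<noteq> 0" by (simp add: lift_def e_def)
        have "eval_poly (P (r n)) (\<chi> i. lift (e n) z $ Some i / lift (e n) z $ None) \<le> 0"
          using P0(3)[of "\<chi> i. lift (e n) z $ Some i / lift (e n) z $ None" "r n"] z N[of "r n"]
          unfolding Y_def e_def by (simp add: P(2) divide_le_0_iff less_imp_le)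
        then have "hom_eval D (P (r n)) (lift (e n) z) \<le> 0"
          unfolding hom_eval_eq[OF P(1) nz]
          by (intro mult_nonneg_nonpos zero_le_even_power assms(4))
        then show ?thesis using Z(3) z by (simp add: mult_nonneg_nonpos)
      qed
      then show "\<exists>N. \<forall>n\<ge>N. (\<Sum>z\<in>Z. w z * hom_eval D (P (r n)) (lift (e n) z)) \<le> 0"
        by (auto intro!: sum_nonpos)
    qed
    ultimately show False by simp
  qed
  moreover have "finite (Y n)" "card (Y n) \<le> card Z" for n
    using Z(1) by (simp_all add: Y_def card_image_le)
  ultimately show ?thesis using Z(2) by (meson order_trans)
qed

theorem theorem5:
  fixes \<mu> :: "(real ^ 'n::finite) measure" and D :: nat
  assumes "D \<ge> 1" and "prob_space \<mu>" and "sets \<mu> = sets borel"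
  shows "(\<exists>X. finite X \<and>
            card X \<le> caratheodory_number (veronese_variety D :: (('n \<Rightarrow>\<^sub>0 nat) \<Rightarrow>\<^sub>0 real) set) \<and>
            weak_net (1 - 1 / real ((CARD('n) + D) choose CARD('n))) \<mu> (Poly_plus D) X) \<and>
         (even D \<and> absolutely_continuous lborel \<mu> \<longrightarrow>
           (\<forall>\<delta>::real. \<delta> > 0 \<longrightarrow>
             (\<exists>X. finite X \<and>
                card X \<le> caratheodory_number
                  (veronese_cone D :: (('n option \<Rightarrow>\<^sub>0 nat) \<Rightarrow>\<^sub>0 real) set) \<and>
                weak_net (1 - 1 / (real ((CARD('n) + D) choose CARD('n)) + 1) + \<delta>)
                  \<mu> (Poly_plus D) X)))"
proof (intro conjI impI allI)
  fix \<delta> :: real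
  assume D: "even D \<and> absolutely_continuous lborel \<mu>" and "\<delta> > 0"
  define m where "m = real ((CARD('n) + D) choose CARD('n))"
  have "m > 0" by (simp add: m_def)
  then have "1 / (m + 1) \<le> 1 / m" by (intro divide_left_mono) auto
  \<comment> \<open>The cone bound holds for every threshold above 1 - 1/m, and the required
    threshold is one of these.\<close>
  with \<open>\<delta> > 0\<close> have "1 - 1 / m < 1 - 1 / (m + 1) + \<delta>" by linarith
  then show "\<exists>X. finite X \<and>
      card X \<le> caratheodory_number (veronese_cone D :: (('n option \<Rightarrow>\<^sub>0 nat) \<Rightarrow>\<^sub>0 real) set) \<and>
      weak_net (1 - 1 / (real ((CARD('n) + D) choose CARD('n)) + 1) + \<delta>) \<mu> (Poly_plus D) X"
    unfolding m_def using D by (intro weak_net_veronese_cone[OF assms(2,3)]) auto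
qed (rule weak_net_veronese_variety[OF assms(2,3)])

end
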